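(* In the setting described in the context, suppose $Y_1=0$, $\Lambda_1=0$, that $\bigcap_{\tau\in[T]}\{x\in\mathcal X: g_\tau(x)\le0\}\ne\emptyset$, that $\|\nabla f_t(x)\|_*\le L_f$ for all $x\in\mathcal X$ and $t\in[T]$, and that $\mathbb E[\|\xi_\tau\|_*^2]\le\sigma^2$ for all $\tau$, with $\sigma>0$. Let $\gamma=\Theta(T^{-1/2})$ and $\alpha=\Theta(T^{-1/2})$ satisfy $$\alpha-\gamma\Big(\alpha^2+\tfrac{C_{1,\psi}^2}{K}\Big)\ge 0.$$ Then for every $r\in[R]$ and $t\in[T]$, the quantity $h\text{-}\mathrm{CFit}^r_t:=\sum_{\tau=1}^t h(g_\tau^r(X_\tau))$ satisfies $$\mathbb E[h\text{-}\mathrm{CFit}^r_t]\le\sqrt{\mathcal D(\mathcal X,\psi)}\,\mathcal O(T^{1/2})+\sqrt{D_{\mathcal X}L_f}\,\mathcal O(T^{3/4})+\Big(C_\psi^2+\tfrac{2\sigma^2}{K}\Big)^{1/2}\mathcal O(T^{1/2}),$$ where $\mathcal D(\mathcal X,\psi)=\sup_{x\in\mathcal X}\psi(x)-\inf_{x\in\mathcal X}\psi(x)$, $D_{\mathcal X}=\sup_{x,y\in\mathcal X}\|x-y\|$ and $C_\psi^2=\tfrac{2C_{2,\psi}^2}{K}+C_3^2$. Here the constants hidden in $\mathcal O(\cdot)$ depend only on the constants $c_1,c_2>0$ in $c_1T^{-1/2}\le\gamma,\alpha\le c_2T^{-1/2}$.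
   Context: Problem data. $T,D,R\in\mathbb N$, $[n]=\{1,\dots,n\}$; $\|\cdot\|$ is a norm on $\mathbb R^D$ with dual norm $\|\cdot\|_*$; $\langle\cdot,\cdot\rangle$ is the standard pairing; $\mathcal X\subset\mathbb R^D$ is nonempty, compact and convex. For $t\in[T]$: $f_t:\mathcal X\to\mathbb R$ is convex and subdifferentiable, with a fixed choice of subgradient $\nabla f_t(x)$ at each $x\in\mathcal X$; $g_t=(g_t^1,\dots,g_t^R)$ with each $g_t^r:\mathcal X\to\mathbb R$ convex and subdifferentiable. The function $h:\mathbb R\to\mathbb R$ is monotonically increasing (nondecreasing) and subdifferentiable on $\mathbb R$ (for every $a\in\mathbb R$ there is $s$ with $h(b)\ge h(a)+s(b-a)$ for all $b$); $h(g_t(x))$ is taken componentwise; $\nabla(h\circ g_t^r)(x)$ is a fixed choice of subgradient of $h\circ g_t^r$ at $x$, and $[\nabla(h\circ g_t)(x)]^{\mathrm T}$ is the $D\times R$ matrix with columns $\nabla(h\circ g_t^1)(x),\dots,\nabla(h\circ g_t^R)(x)$. The sequences $f_t,g_t$ are deterministic. Regularizer. $K>0$ and $\psi:\mathcal X\to\mathbb R$ is continuous and $K$-strongly convex with respect to $\|\cdot\|$; the mirror map is $\Phi(y)=\arg\max_{x\in\mathcal X}\{\langle y,x\rangle-\psi(x)\}$. Noise. $(\Omega,\Sigma,\mathbb P)$ is a probability space with filtration $(\mathcal F_t)_{t\in\mathbb N_0}$, and $(\xi_t)_{t\in\mathbb N}$ is an $\mathbb R^D$-valued martingale difference sequence ($\xi_t$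 is $\mathcal F_t$-measurable and integrable, $\mathbb E[\xi_t\mid\mathcal F_{t-1}]=0$). The iterates $X_t$ below are $\mathcal F_t$-measurable. Algorithm (GOMSP). Parameters $\gamma,\alpha>0$; deterministic $Y_1\in\mathbb R^D$, $\Lambda_1\in\mathbb R^R_{\ge0}$, $X_1=\Phi(Y_1)$. For $t=1,\dots,T$: $\hat v_t=\nabla f_t(X_t)+\xi_{t+1}$, $Y_{t+1}=Y_t-\gamma\big(\hat v_t+[\nabla(h\circ g_t)(X_t)]^{\mathrm T}\Lambda_t\big)$, $\Lambda_{t+1}=\Pi_{\mathbb R^R_{\ge0}}\big[(1-\alpha\gamma)\Lambda_t+\gamma h(g_t(X_t))\big]$ (Euclidean projection), $X_{t+1}=\Phi(Y_{t+1})$. Constants. $C_{1,\psi},C_{2,\psi}$ are the smallest constants with $\|[\nabla(h\circ g_t)(x)]^{\mathrm T}\lambda\|_*\le C_{1,\psi}\|\lambda\|_2$ and $\|\nabla f_t(x)\|_*\le C_{2,\psi}$ for all $t\in[T]$, $x\in\mathcal X$, $\lambda\in\mathbb R^R_{\ge0}$; $C_3>0$ satisfies $\|h(g_t(x))\|_2\le C_3$ for all $t\in[T]$, $x\in\mathcal X$.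
   Formalization: The formal theorem adds the assumption h(0) ≤ 0, without which the claim fails (h ≡ 1, f_t = g_t = 0, X a point gives h-CFit_T = T); the O-constants are stated for each fixed carrier type of the sample space Ω. *)

theory Defs
  imports "HOL-Probability.Probability" "HOL-Library.Function_Algebras"
begin

section \<open>Finite-dimensional real space with the dimension as a term\<close>

text \<open>
  The bound under study has constants that must not depend on the dimensions, so the dimensions
  have to be quantified inside the statement.  Hence a vector of length \<open>n\<close> is a function
  on the naturals that vanishes off the index set \<open>{1..n}\<close>.  The topology and the Borel sets of
  the function type are those of the product; on the vectors of length \<open>n\<close> they induce the
  Euclidean ones.
\<close>

type_synonym rvec = "nat \<Rightarrow> real"

instantiation "fun" :: (type, real_vector) real_vector
begin

definition scaleR_fun :: "real \<Rightarrow> ('a \<Rightarrow> 'b) \<Rightarrow> 'a \<Rightarrow> 'b" where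
  "scaleR_fun c f = (\<lambda>x. c *\<^sub>R f x)"

instance
  by standard (simp_all add: scaleR_fun_def fun_eq_iff scaleR_add_right scaleR_add_left)

end

lemma scaleR_fun_apply [simp]: "(c *\<^sub>R f) x = c *\<^sub>R f x"
  by (simp add: scaleR_fun_def)

definition vecs :: "nat \<Rightarrow> rvec set" where
  "vecs n = {x. \<forall>i. i \<notin> {1..n} \<longrightarrow> x i = 0}"

definition nonneg_vecs :: "nat \<Rightarrow> rvec set" where
  "nonneg_vecs n = {x \<in> vecs n. \<forall>i\<in>{1..n}. 0 \<le> x i}"

definition pairing :: "nat \<Rightarrow> rvec \<Rightarrow> rvec \<Rightarrow> real" where
  "pairing n y x = (\<Sum>i\<in>{1..n}. y i * x i)"

definition norm2 :: "nat \<Rightarrow> rvec \<Rightarrow> real" where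
  "norm2 n x = L2_set x {1..n}"

definition is_norm :: "nat \<Rightarrow> (rvec \<Rightarrow> real) \<Rightarrow> bool" where
  "is_norm n N \<longleftrightarrow>
     (\<forall>x\<in>vecs n. 0 \<le> N x \<and> (N x = 0 \<longleftrightarrow> x = 0)) \<and>
     (\<forall>x\<in>vecs n. \<forall>c. N (c *\<^sub>R x) = \<bar>c\<bar> * N x) \<and>
     (\<forall>x\<in>vecs n. \<forall>y\<in>vecs n. N (x + y) \<le> N x + N y)"

definition dual_norm :: "nat \<Rightarrow> (rvec \<Rightarrow> real) \<Rightarrow> rvec \<Rightarrow> real" where
  "dual_norm n N y = (SUP x\<in>{x \<in> vecs n. N x \<le> 1}. pairing n y x)"

definition euclid_proj :: "nat \<Rightarrow> rvec set \<Rightarrow> rvec \<Rightarrow> rvec" where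
  "euclid_proj n S z = arg_min_on (\<lambda>u. norm2 n (u - z)) S"

definition is_subgradient ::
  "nat \<Rightarrow> rvec set \<Rightarrow> (rvec \<Rightarrow> real) \<Rightarrow> rvec \<Rightarrow> rvec \<Rightarrow> bool" where
  "is_subgradient n S f x s \<longleftrightarrow> s \<in> vecs n \<and> (\<forall>y\<in>S. f y \<ge> f x + pairing n s (y - x))"

definition strongly_convex_on ::
  "rvec set \<Rightarrow> (rvec \<Rightarrow> real) \<Rightarrow> real \<Rightarrow> (rvec \<Rightarrow> real) \<Rightarrow> bool" where
  "strongly_convex_on S N K \<psi> \<longleftrightarrow>
     (\<forall>x\<in>S. \<forall>y\<in>S. \<forall>u\<in>{0..1}.
        \<psi> (u *\<^sub>R x + (1 - u) *\<^sub>R y)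
          \<le> u * \<psi> x + (1 - u) * \<psi> y - K / 2 * u * (1 - u) * (N (x - y))\<^sup>2)"

definition mirror_map :: "nat \<Rightarrow> rvec set \<Rightarrow> (rvec \<Rightarrow> real) \<Rightarrow> rvec \<Rightarrow> rvec" where
  "mirror_map n S \<psi> y = arg_max_on (\<lambda>x. pairing n y x - \<psi> x) S"

text \<open>The matrix with columns \<open>G 1, \<dots>, G n\<close>, applied to \<open>l\<close>.\<close>

definition cols_mult :: "nat \<Rightarrow> (nat \<Rightarrow> rvec) \<Rightarrow> rvec \<Rightarrow> rvec" where
  "cols_mult n G l = (\<Sum>r\<in>{1..n}. l r *\<^sub>R G r)"

definition is_smallest :: "real set \<Rightarrow> real \<Rightarrow> bool" where
  "is_smallest A c \<longleftrightarrow> c \<in> A \<and> (\<forall>a\<in>A. c \<le> a)"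


section \<open>Constrained online convex problems\<close>

text \<open>\<open>df t x\<close> and \<open>dhg t r x\<close> are the chosen subgradients at \<open>x\<close> of \<open>f t\<close> and of
  \<open>h \<circ> g t r\<close>.\<close>

locale online_problem =
  fixes T D R :: nat
    and N :: "rvec \<Rightarrow> real"
    and \<X> :: "rvec set"
    and f :: "nat \<Rightarrow> rvec \<Rightarrow> real"
    and df :: "nat \<Rightarrow> rvec \<Rightarrow> rvec"
    and g :: "nat \<Rightarrow> nat \<Rightarrow> rvec \<Rightarrow> real"
    and h :: "real \<Rightarrow> real"
    and dhg :: "nat \<Rightarrow> nat \<Rightarrow> rvec \<Rightarrow> rvec"
  assumes T_pos: "0 < T" and D_pos: "0 < D" and R_pos: "0 < R"
    and N_norm: "is_norm D N"
    and dom_subset: "\<X> \<subseteq> vecs D"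
    and dom_nonempty: "\<X> \<noteq> {}"
    and dom_compact: "compact \<X>"
    and dom_convex: "convex \<X>"
    and f_convex: "\<And>t. t \<in> {1..T} \<Longrightarrow> convex_on \<X> (f t)"
    and f_subgradient: "\<And>t x. t \<in> {1..T} \<Longrightarrow> x \<in> \<X> \<Longrightarrow> is_subgradient D \<X> (f t) x (df t x)"
    and g_convex: "\<And>t r. t \<in> {1..T} \<Longrightarrow> r \<in> {1..R} \<Longrightarrow> convex_on \<X> (g t r)"
    and g_subdifferentiable:
      "\<And>t r x. t \<in> {1..T} \<Longrightarrow> r \<in> {1..R} \<Longrightarrow> x \<in> \<X> \<Longrightarrow> \<exists>s. is_subgradient D \<X> (g t r) x s"
    and h_mono: "mono h"
    and h_subdifferentiable: "\<And>a. \<exists>s. \<forall>b. h b \<ge> h a + s * (b - a)"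
    and hg_subgradient:
      "\<And>t r x. t \<in> {1..T} \<Longrightarrow> r \<in> {1..R} \<Longrightarrow> x \<in> \<X> \<Longrightarrow>
         is_subgradient D \<X> (\<lambda>y. h (g t r y)) x (dhg t r x)"

definition h_constraints ::
  "nat \<Rightarrow> (real \<Rightarrow> real) \<Rightarrow> (nat \<Rightarrow> nat \<Rightarrow> rvec \<Rightarrow> real) \<Rightarrow> nat \<Rightarrow> rvec \<Rightarrow> rvec" where
  "h_constraints R h g t x = (\<lambda>r. if r \<in> {1..R} then h (g t r x) else 0)"

definition C1_bounds ::
  "nat \<Rightarrow> nat \<Rightarrow> nat \<Rightarrow> (rvec \<Rightarrow> real) \<Rightarrow> rvec set \<Rightarrow> (nat \<Rightarrow> nat \<Rightarrow> rvec \<Rightarrow> rvec) \<Rightarrow> real set" where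
  "C1_bounds T D R N \<X> dhg =
     {c. \<forall>t\<in>{1..T}. \<forall>x\<in>\<X>. \<forall>l\<in>nonneg_vecs R.
           dual_norm D N (cols_mult R (\<lambda>r. dhg t r x) l) \<le> c * norm2 R l}"

definition C2_bounds ::
  "nat \<Rightarrow> nat \<Rightarrow> (rvec \<Rightarrow> real) \<Rightarrow> rvec set \<Rightarrow> (nat \<Rightarrow> rvec \<Rightarrow> rvec) \<Rightarrow> real set" where
  "C2_bounds T D N \<X> df = {c. \<forall>t\<in>{1..T}. \<forall>x\<in>\<X>. dual_norm D N (df t x) \<le> c}"

definition diam_wrt :: "(rvec \<Rightarrow> real) \<Rightarrow> rvec set \<Rightarrow> real" where
  "diam_wrt N \<X> = (SUP (x, y)\<in>\<X> \<times> \<X>. N (x - y))"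

definition range_width :: "rvec set \<Rightarrow> (rvec \<Rightarrow> real) \<Rightarrow> real" where
  "range_width \<X> \<psi> = (SUP x\<in>\<X>. \<psi> x) - (INF x\<in>\<X>. \<psi> x)"


section \<open>The noisy primal-dual mirror algorithm\<close>

locale martingale_noise = prob_space M + filtration "space M" F
  for M :: "'w measure" and F :: "nat \<Rightarrow> 'w measure" +
  fixes D :: nat
    and \<xi> :: "nat \<Rightarrow> 'w \<Rightarrow> rvec"
  assumes F_subalgebra: "\<And>t. subalgebra M (F t)"
    and noise_range: "\<And>t \<omega>. t \<ge> 1 \<Longrightarrow> \<omega> \<in> space M \<Longrightarrow> \<xi> t \<omega> \<in> vecs D"
    and noise_adapted: "\<And>t. t \<ge> 1 \<Longrightarrow> \<xi> t \<in> F t \<rightarrow>\<^sub>M borel"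
    and noise_integrable: "\<And>t i. t \<ge> 1 \<Longrightarrow> i \<in> {1..D} \<Longrightarrow> integrable M (\<lambda>\<omega>. \<xi> t \<omega> i)"
    and noise_centered:
      "\<And>t i. t \<ge> 1 \<Longrightarrow> i \<in> {1..D} \<Longrightarrow>
         AE \<omega> in M. real_cond_exp M (F (t - 1)) (\<lambda>\<omega>. \<xi> t \<omega> i) \<omega> = 0"

locale gomsp =
  online_problem T D R N \<X> f df g h dhg + martingale_noise M F D \<xi>
  for T D R :: nat
    and N :: "rvec \<Rightarrow> real"
    and \<X> :: "rvec set"
    and f :: "nat \<Rightarrow> rvec \<Rightarrow> real"
    and df :: "nat \<Rightarrow> rvec \<Rightarrow> rvec"
    and g :: "nat \<Rightarrow> nat \<Rightarrow> rvec \<Rightarrow> real"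
    and h :: "real \<Rightarrow> real"
    and dhg :: "nat \<Rightarrow> nat \<Rightarrow> rvec \<Rightarrow> rvec"
    and M :: "'w measure"
    and F :: "nat \<Rightarrow> 'w measure"
    and \<xi> :: "nat \<Rightarrow> 'w \<Rightarrow> rvec" +
  fixes K :: real
    and \<psi> :: "rvec \<Rightarrow> real"
    and \<gamma> \<alpha> :: real
    and y\<^sub>1 l\<^sub>1 :: rvec
    and Y \<Lambda> X :: "nat \<Rightarrow> 'w \<Rightarrow> rvec"
  assumes K_pos: "0 < K"
    and \<psi>_continuous: "continuous_on \<X> \<psi>"
    and \<psi>_strongly_convex: "strongly_convex_on \<X> N K \<psi>"
    and \<gamma>_pos: "0 < \<gamma>" and \<alpha>_pos: "0 < \<alpha>"
    and y\<^sub>1_vec: "y\<^sub>1 \<in> vecs D"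
    and l\<^sub>1_nonneg: "l\<^sub>1 \<in> nonneg_vecs R"
    and Y_init: "\<And>\<omega>. \<omega> \<in> space M \<Longrightarrow> Y 1 \<omega> = y\<^sub>1"
    and \<Lambda>_init: "\<And>\<omega>. \<omega> \<in> space M \<Longrightarrow> \<Lambda> 1 \<omega> = l\<^sub>1"
    and Y_step: "\<And>t \<omega>. t \<in> {1..T} \<Longrightarrow> \<omega> \<in> space M \<Longrightarrow>
      Y (t + 1) \<omega> = Y t \<omega> - \<gamma> *\<^sub>R ((df t (X t \<omega>) + \<xi> (t + 1) \<omega>)
                                  + cols_mult R (\<lambda>r. dhg t r (X t \<omega>)) (\<Lambda> t \<omega>))"
    and \<Lambda>_step: "\<And>t \<omega>. t \<in> {1..T} \<Longrightarrow> \<omega> \<in> space M \<Longrightarrow>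
      \<Lambda> (t + 1) \<omega> = euclid_proj R (nonneg_vecs R)
         ((1 - \<alpha> * \<gamma>) *\<^sub>R \<Lambda> t \<omega> + \<gamma> *\<^sub>R h_constraints R h g t (X t \<omega>))"
    and X_def: "\<And>t \<omega>. t \<in> {1..T + 1} \<Longrightarrow> \<omega> \<in> space M \<Longrightarrow> X t \<omega> = mirror_map D \<X> \<psi> (Y t \<omega>)"
    and X_adapted: "\<And>t. t \<in> {1..T + 1} \<Longrightarrow> X t \<in> F t \<rightarrow>\<^sub>M borel"

definition h_CFit ::
  "(real \<Rightarrow> real) \<Rightarrow> (nat \<Rightarrow> nat \<Rightarrow> rvec \<Rightarrow> real) \<Rightarrow> (nat \<Rightarrow> 'w \<Rightarrow> rvec) \<Rightarrow> nat \<Rightarrow> nat \<Rightarrow> 'w \<Rightarrow> real" where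
  "h_CFit h g X r t \<omega> = (\<Sum>\<tau>\<in>{1..t}. h (g \<tau> r (X \<tau> \<omega>)))"

end

theory Submission
  imports Defs
begin

text \<open>
  With the conjugate \<open>\<psi>\<^sup>*\<close> of the regularizer, which is \<open>1/K\<close>-smooth with gradient the mirror map,
  a feasible point \<open>z\<close> and a fixed multiplier \<open>l \<ge> 0\<close>, consider the potential
  \<open>\<psi>\<^sup>*(Y\<^sub>t) - \<langle>Y\<^sub>t, z\<rangle> + \<parallel>\<Lambda>\<^sub>t - l\<parallel>\<^sup>2 / 2\<close>.  Convexity of \<open>h \<circ> g\<close> makes the terms coupling
  \<open>\<Lambda>\<^sub>t\<close> with the constraints cancel between the primal and the dual step, and the condition on the
  step sizes absorbs the remaining multiples of \<open>\<parallel>\<Lambda>\<^sub>t\<parallel>\<^sup>2\<close>.  What is left bounds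
  \<open>\<gamma> * \<langle>h(g\<^sub>t(X\<^sub>t)), l\<rangle>\<close> by the decrease of the potential, deterministic terms, and a martingale
  difference.  For \<open>l = a * e\<^sub>r\<close>, summation and expectation yield \<open>\<gamma> * a * m \<le> P + q * a\<^sup>2\<close> for
  the expected violation \<open>m\<close> and all \<open>a \<ge> 0\<close>; the choice \<open>a = sqrt (P / q)\<close> gives the rates.
\<close>

section \<open>Vectors and norms\<close>

lemma vecs_arith [simp]:
  "0 \<in> vecs n"
  "x \<in> vecs n \<Longrightarrow> y \<in> vecs n \<Longrightarrow> x + y \<in> vecs n"
  "x \<in> vecs n \<Longrightarrow> y \<in> vecs n \<Longrightarrow> x - y \<in> vecs n"
  "x \<in> vecs n \<Longrightarrow> c *\<^sub>R x \<in> vecs n"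
  by (auto simp: vecs_def)

lemma pairing_linear:
  "pairing n (y + z) x = pairing n y x + pairing n z x"
  "pairing n (y - z) x = pairing n y x - pairing n z x"
  "pairing n (c *\<^sub>R y) x = c * pairing n y x"
  "pairing n y (x + w) = pairing n y x + pairing n y w"
  "pairing n y (x - w) = pairing n y x - pairing n y w"
  "pairing n y (c *\<^sub>R x) = c * pairing n y x"
  by (simp_all add: pairing_def distrib_left distrib_right left_diff_distrib right_diff_distrib
      sum.distrib sum_subtractf sum_distrib_left mult_ac)

lemma pairing_zero [simp]: "pairing n 0 x = 0" "pairing n y 0 = 0"
  by (simp_all add: pairing_def)

lemma sum_fun_apply: "(\<Sum>i\<in>A. F i) x = (\<Sum>i\<in>A. F i x)"
  for F :: "'i \<Rightarrow> 'a \<Rightarrow> 'b :: comm_monoid_add"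
  by (induction A rule: infinite_finite_induct) auto

lemma pairing_cols_mult: "pairing n (cols_mult m G l) x = (\<Sum>r\<in>{1..m}. l r * pairing n (G r) x)"
proof -
  have "pairing n (cols_mult m G l) x = (\<Sum>i\<in>{1..n}. \<Sum>r\<in>{1..m}. l r * (G r i * x i))"
    by (simp add: pairing_def cols_mult_def sum_fun_apply sum_distrib_right mult.assoc)
  also have "\<dots> = (\<Sum>r\<in>{1..m}. \<Sum>i\<in>{1..n}. l r * (G r i * x i))"
    by (rule sum.swap)
  finally show ?thesis
    by (simp add: pairing_def sum_distrib_left)
qed

lemma norm2_squared: "(norm2 n x)\<^sup>2 = (\<Sum>i\<in>{1..n}. (x i)\<^sup>2)"
  by (simp add: norm2_def L2_set_def sum_nonneg)

lemma continuous_on_coordinate: "continuous_on S (\<lambda>x::rvec. x i)"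
  by (rule continuous_on_subset[OF continuous_on_product_coordinates subset_UNIV])

lemma continuous_on_pairing: "continuous_on S (pairing n y)"
  unfolding pairing_def by (intro continuous_intros continuous_on_coordinate)

definition unit_vec :: "nat \<Rightarrow> rvec" where
  "unit_vec i = (\<lambda>j. if j = i then 1 else 0)"

lemma unit_vec_in_vecs [simp]: "i \<in> {1..n} \<Longrightarrow> unit_vec i \<in> vecs n"
  by (auto simp: unit_vec_def vecs_def)

lemma vec_expansion:
  assumes "x \<in> vecs n"
  shows "x = (\<Sum>i\<in>{1..n}. x i *\<^sub>R unit_vec i)"
proof
  fix j
  have "(\<Sum>i\<in>{1..n}. x i *\<^sub>R unit_vec i) j = (\<Sum>i\<in>{1..n}. if j = i then x i else 0)"
    unfolding sum_fun_apply by (intro sum.cong) (auto simp: unit_vec_def)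
  also have "\<dots> = x j"
    using assms by (auto simp: vecs_def)
  finally show "x j = (\<Sum>i\<in>{1..n}. x i *\<^sub>R unit_vec i) j" ..
qed

section \<open>Abstract norms, their continuity and their dual norms\<close>

locale vec_norm =
  fixes n :: nat and N :: "rvec \<Rightarrow> real"
  assumes is_norm: "is_norm n N"
begin

lemma norm_nonneg: "x \<in> vecs n \<Longrightarrow> 0 \<le> N x"
  and norm_eq_0_iff: "x \<in> vecs n \<Longrightarrow> N x = 0 \<longleftrightarrow> x = 0"
  and norm_scale: "x \<in> vecs n \<Longrightarrow> N (c *\<^sub>R x) = \<bar>c\<bar> * N x"
  and norm_triangle: "x \<in> vecs n \<Longrightarrow> y \<in> vecs n \<Longrightarrow> N (x + y) \<le> N x + N y"
  using is_norm by (auto simp: is_norm_def)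

lemma norm_zero: "N 0 = 0"
  using norm_eq_0_iff[of 0] by simp

lemma norm_minus_commute:
  assumes "x \<in> vecs n" "y \<in> vecs n"
  shows "N (x - y) = N (y - x)"
proof -
  have "x - y = (-1) *\<^sub>R (y - x)" by (simp add: fun_eq_iff)
  then show ?thesis using norm_scale[of "y - x" "-1"] assms by simp
qed

lemma norm_sum_le:
  assumes "\<And>i. i \<in> I \<Longrightarrow> F i \<in> vecs n"
  shows "sum F I \<in> vecs n \<and> N (sum F I) \<le> (\<Sum>i\<in>I. N (F i))"
  using assms
proof (induction I rule: infinite_finite_induct)
  case (insert i I)
  then have "N (F i + sum F I) \<le> N (F i) + N (sum F I)"
    by (intro norm_triangle) simp_all
  moreover have "F i + sum F I \<in> vecs n"
    using insert by (intro vecs_arith(2)) simp_all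
  moreover have "sum F (insert i I) = F i + sum F I" "(\<Sum>j\<in>insert i I. N (F j)) = N (F i) + (\<Sum>j\<in>I. N (F j))"
    using insert.hyps by (rule sum.insert)+
  moreover have "N (sum F I) \<le> (\<Sum>j\<in>I. N (F j))"
    using insert by simp
  ultimately show ?case by (metis add_left_mono order_trans)
qed (simp_all add: norm_zero)

lemma norm_le_coordinates:
  assumes "x \<in> vecs n"
  shows "N x \<le> (\<Sum>i\<in>{1..n}. \<bar>x i\<bar> * N (unit_vec i))"
proof -
  have "N (\<Sum>i\<in>{1..n}. x i *\<^sub>R unit_vec i) \<le> (\<Sum>i\<in>{1..n}. N (x i *\<^sub>R unit_vec i))"
    using norm_sum_le[of "{1..n}" "\<lambda>i. x i *\<^sub>R unit_vec i"] by (meson unit_vec_in_vecs vecs_arith(4))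
  also have "\<dots> = (\<Sum>i\<in>{1..n}. \<bar>x i\<bar> * N (unit_vec i))"
    by (intro sum.cong norm_scale unit_vec_in_vecs) simp_all
  finally show ?thesis
    unfolding vec_expansion[OF assms, symmetric] .
qed

lemma norm_diff_le:
  assumes "x \<in> vecs n" "y \<in> vecs n"
  shows "\<bar>N x - N y\<bar> \<le> N (x - y)"
proof -
  have "N (y + (x - y)) \<le> N y + N (x - y)" "N (x + (y - x)) \<le> N x + N (y - x)"
    using assms by (intro norm_triangle; simp)+
  then show ?thesis using norm_minus_commute[OF assms] by simp
qed

text \<open>Continuity refers to the product topology on \<open>rvec\<close>, so a Lipschitz bound
  in \<open>N\<close> has to be transferred. By \<open>norm_le_coordinates\<close> it is dominated
  by a weighted sum of coordinate distances, which is continuous in that topology and vanishes at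
  the point in question.\<close>

lemma continuous_on_if_lipschitz:
  fixes \<phi> :: "rvec \<Rightarrow> real"
  assumes "S \<subseteq> vecs n"
    and lip: "\<And>x y. x \<in> S \<Longrightarrow> y \<in> S \<Longrightarrow> \<bar>\<phi> x - \<phi> y\<bar> \<le> C * N (x - y)"
  shows "continuous_on S \<phi>"
  unfolding continuous_on_def
proof
  fix x assume x: "x \<in> S"
  define b where "b y = \<bar>C\<bar> * (\<Sum>i\<in>{1..n}. \<bar>y i - x i\<bar> * N (unit_vec i))" for y
  have "continuous_on S b"
    unfolding b_def by (intro continuous_intros continuous_on_coordinate)
  moreover have b0: "b x = 0"
    by (simp add: b_def)
  ultimately have b: "(b \<longlongrightarrow> 0) (at x within S)"
    unfolding continuous_on_def using x by (metis (no_types) b0)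
  have "norm (\<phi> y - \<phi> x) \<le> b y" if "y \<in> S" for y
  proof -
    have y: "y - x \<in> vecs n" using that x assms(1) by (meson subsetD vecs_arith(3))
    have "norm (\<phi> y - \<phi> x) \<le> \<bar>C\<bar> * N (y - x)"
      using lip[OF that x] norm_nonneg[OF y]
      by (smt (verit) mult_right_mono real_norm_def)
    also have "\<dots> \<le> b y"
      unfolding b_def using norm_le_coordinates[OF y] by (intro mult_left_mono) auto
    finally show ?thesis .
  qed
  then have "\<forall>\<^sub>F y in at x within S. norm (\<phi> y - \<phi> x) \<le> b y"
    by (auto simp: eventually_at_filter)
  then have "((\<lambda>y. \<phi> y - \<phi> x) \<longlongrightarrow> 0) (at x within S)"
    using b by (rule Lim_null_comparison)
  then show "(\<phi> \<longlongrightarrow> \<phi> x) (at x within S)"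
    by (simp add: LIM_zero_iff)
qed

lemma continuous_on_norm: "S \<subseteq> vecs n \<Longrightarrow> continuous_on S N"
  by (rule continuous_on_if_lipschitz[where C = 1]) (auto intro!: norm_diff_le)

text \<open>\<open>N\<close> attains a positive minimum on the unit sphere of the maximum norm, and
  homogeneity extends the resulting bound to all vectors. With \<open>norm_le_coordinates\<close>
  this is the equivalence of norms in finite dimension.\<close>

lemma coordinate_le_norm:
  obtains B where "0 \<le> B" "\<And>x i. x \<in> vecs n \<Longrightarrow> \<bar>x i\<bar> \<le> B * N x"
proof (cases "n = 0")
  case True
  then have "\<bar>x i\<bar> \<le> 0 * N x" if "x \<in> vecs n" for x i
    using that by (auto simp: vecs_def)
  then show ?thesis using that[of 0] by auto
next
  case False
  \<comment> \<open>The unit cube, with factors \<open>{0}\<close> outside \<open>{1..n}\<close> so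
    that it stays inside \<open>vecs n\<close> and is compact as a product of compact sets.
    \<open>S\<close> is the unit sphere of the maximum norm; for \<open>n = 0\<close> it would be
    empty.\<close>
  define box :: "rvec set" where
    "box = PiE UNIV (\<lambda>i. if i \<in> {1..n} then {-1..1} else {0})"
  define S where "S = box \<inter> (\<Union>i\<in>{1..n}. {x. \<bar>x i\<bar> = 1})"
  have "compactin (product_topology (\<lambda>i. euclidean) UNIV) box"
    unfolding box_def compactin_PiE by simp
  then have "compact box"
    by (simp add: euclidean_product_topology)
  moreover have "closed {x::rvec. \<bar>x i\<bar> = 1}" for i
    by (intro closed_Collect_eq continuous_intros continuous_on_coordinate)
  ultimately have "compact S"
    unfolding S_def by (intro compact_Int_closed closed_UN) auto
  moreover have "unit_vec 1 \<in> S"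
    using False by (auto simp: S_def box_def unit_vec_def PiE_def)
  moreover have S: "S \<subseteq> vecs n"
    by (auto simp: S_def box_def vecs_def PiE_def Pi_def)
  ultimately obtain z where z: "z \<in> S" "\<And>x. x \<in> S \<Longrightarrow> N z \<le> N x"
    using continuous_attains_inf[of S N] continuous_on_norm by blast
  have "z \<noteq> 0" using z(1) by (auto simp: S_def)
  then have pos: "0 < N z"
    using norm_eq_0_iff[of z] norm_nonneg[of z] z(1) S by auto
  have "\<bar>x i\<bar> \<le> (1 / N z) * N x" if x: "x \<in> vecs n" for x i
  proof (cases "x = 0")
    case True
    then show ?thesis by (simp add: norm_zero)
  next
    case x0: False
    \<comment> \<open>The maximum norm of \<open>x\<close>; dividing by it moves \<open>x\<close>
      onto the sphere \<open>S\<close>.\<close>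
    define c where "c = Max ((\<lambda>i. \<bar>x i\<bar>) ` {1..n})"
    have le: "\<bar>x i\<bar> \<le> c" if "i \<in> {1..n}" for i
      unfolding c_def using that by (intro Max_ge) auto
    have "c \<in> (\<lambda>i. \<bar>x i\<bar>) ` {1..n}"
      unfolding c_def using False by (intro Max_in) auto
    then obtain j where j: "j \<in> {1..n}" "\<bar>x j\<bar> = c" by auto
    from x0 x obtain k where "k \<in> {1..n}" "x k \<noteq> 0"
      by (auto simp: vecs_def fun_eq_iff)
    then have c: "0 < c" using le[of k] by simp
    have "(1 / c) *\<^sub>R x \<in> box"
      unfolding box_def
    proof (rule PiE_I)
      fix i
      have "\<bar>x i / c\<bar> \<le> 1" if "i \<in> {1..n}" using le[OF that] c by simp
      then show "((1 / c) *\<^sub>R x) i \<in> (if i \<in> {1..n} then {-1..1} else {0})"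
        using x abs_le_iff[of "x i / c" 1] by (cases "i \<in> {1..n}") (simp_all add: vecs_def)
    qed simp
    moreover have "\<bar>((1 / c) *\<^sub>R x) j\<bar> = 1" using j(2) c by simp
    ultimately have "(1 / c) *\<^sub>R x \<in> S" unfolding S_def using j(1) by blast
    from z(2)[OF this] have "N z * c \<le> N x"
      using c x by (simp add: norm_scale field_simps)
    then have "c \<le> (1 / N z) * N x" using pos by (simp add: field_simps)
    moreover have "\<bar>x i\<bar> \<le> c"
      using le[of i] x c by (cases "i \<in> {1..n}") (auto simp: vecs_def)
    ultimately show ?thesis by linarith
  qed
  then show ?thesis using that[of "1 / N z"] pos by simp
qed

text \<open>The dual norm is a supremum of reals, so it dominates the pairings on the unit ball only
  once these are known to be bounded.\<close>

lemma bdd_above_pairing_unit_ball: "bdd_above (pairing n y ` {x \<in> vecs n. N x \<le> 1})"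
proof -
  obtain B where B: "0 \<le> B" "\<And>x i. x \<in> vecs n \<Longrightarrow> \<bar>x i\<bar> \<le> B * N x"
    by (rule coordinate_le_norm) blast
  show ?thesis
  proof (rule bdd_aboveI2)
    fix x assume x: "x \<in> {x \<in> vecs n. N x \<le> 1}"
    show "pairing n y x \<le> (\<Sum>i\<in>{1..n}. \<bar>y i\<bar> * B)"
      unfolding pairing_def
    proof (rule sum_mono)
      fix i
      have "\<bar>x i\<bar> \<le> B"
        using B(2)[of x i] mult_left_mono[of "N x" 1 B] B(1) x by auto
      then have "\<bar>y i\<bar> * \<bar>x i\<bar> \<le> \<bar>y i\<bar> * B" by (intro mult_left_mono) auto
      then show "y i * x i \<le> \<bar>y i\<bar> * B"
        using abs_ge_self[of "y i * x i"] by (simp add: abs_mult)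
    qed
  qed
qed

lemma dual_norm_nonneg: "0 \<le> dual_norm n N y"
proof -
  have "pairing n y 0 \<le> dual_norm n N y"
    unfolding dual_norm_def
    by (rule cSUP_upper[of 0 _ "pairing n y", OF _ bdd_above_pairing_unit_ball]) (simp add: norm_zero)
  then show ?thesis by simp
qed

lemma pairing_le_dual_norm:
  assumes "x \<in> vecs n"
  shows "pairing n y x \<le> dual_norm n N y * N x"
proof (cases "x = 0")
  case False
  then have pos: "0 < N x"
    using norm_eq_0_iff[OF assms] norm_nonneg[OF assms] by auto
  then have "pairing n y ((1 / N x) *\<^sub>R x) \<le> dual_norm n N y"
    unfolding dual_norm_def using assms
    by (intro cSUP_upper[of "(1 / N x) *\<^sub>R x" _ "pairing n y", OF _ bdd_above_pairing_unit_ball])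
      (simp add: norm_scale)
  then show ?thesis using pos by (simp add: pairing_linear field_simps)
qed (simp add: norm_zero)

lemma dual_norm_leI:
  assumes "\<And>x. x \<in> vecs n \<Longrightarrow> N x \<le> 1 \<Longrightarrow> pairing n y x \<le> c"
  shows "dual_norm n N y \<le> c"
  unfolding dual_norm_def
proof (rule cSUP_least)
  have "0 \<in> {x \<in> vecs n. N x \<le> 1}" by (simp add: norm_zero)
  then show "{x \<in> vecs n. N x \<le> 1} \<noteq> {}" by blast
qed (use assms in auto)

lemma dual_norm_triangle: "dual_norm n N (y + z) \<le> dual_norm n N y + dual_norm n N z"
proof (rule dual_norm_leI)
  fix x assume x: "x \<in> vecs n" "N x \<le> 1"
  have "pairing n u x \<le> dual_norm n N u" for u
    using pairing_le_dual_norm[OF x(1), of u] mult_left_mono[OF x(2) dual_norm_nonneg[of u]]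
    by simp
  then show "pairing n (y + z) x \<le> dual_norm n N y + dual_norm n N z"
    unfolding pairing_linear by (intro add_mono)
qed

lemma dual_norm_scale_le: "dual_norm n N (c *\<^sub>R y) \<le> \<bar>c\<bar> * dual_norm n N y"
proof (rule dual_norm_leI)
  fix x assume x: "x \<in> vecs n" "N x \<le> 1"
  have "pairing n (c *\<^sub>R y) x = pairing n y (c *\<^sub>R x)" by (simp add: pairing_linear)
  also have "\<dots> \<le> dual_norm n N y * N (c *\<^sub>R x)"
    using x by (intro pairing_le_dual_norm) simp
  also have "\<dots> \<le> dual_norm n N y * \<bar>c\<bar>"
    using x mult_left_mono[of "N x" 1 "\<bar>c\<bar>"] by (intro mult_left_mono dual_norm_nonneg)
      (simp add: norm_scale)
  finally show "pairing n (c *\<^sub>R y) x \<le> \<bar>c\<bar> * dual_norm n N y" by (simp add: mult.commute)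
qed

end

section \<open>Projection onto the nonnegative orthant, and unit vectors\<close>

lemma euclid_proj_nonneg_vecs:
  assumes z: "z \<in> vecs n"
  shows "euclid_proj n (nonneg_vecs n) z = (\<lambda>i. max 0 (z i))"
proof -
  let ?S = "nonneg_vecs n" and ?p = "\<lambda>i. max 0 (z i)" and ?d = "\<lambda>u. norm2 n (u - z)"
  have p: "?p \<in> ?S" using z by (auto simp: nonneg_vecs_def vecs_def)
  have le: "(?p i - z i)\<^sup>2 \<le> (u i - z i)\<^sup>2" if "u \<in> ?S" "i \<in> {1..n}" for u i
  proof (cases "0 \<le> z i")
    case False
    have "0 \<le> u i" using that by (simp add: nonneg_vecs_def)
    then have "\<bar>?p i - z i\<bar> \<le> \<bar>u i - z i\<bar>" using False by simp
    then show ?thesis by (rule abs_le_square_iff[THEN iffD1])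
  qed simp
  have d_mono: "?d u \<le> ?d v \<longleftrightarrow> (\<Sum>i\<in>{1..n}. (u i - z i)\<^sup>2) \<le> (\<Sum>i\<in>{1..n}. (v i - z i)\<^sup>2)" for u v
    by (simp add: norm2_def L2_set_def)
  have "is_arg_min ?d (\<lambda>u. u \<in> ?S) ?p"
    using p le unfolding is_arg_min_linorder d_mono by (auto intro!: sum_mono)
  \<comment> \<open>\<open>arg_min\<close> is a Hilbert choice, so its value is known only once the
    minimizer is unique.\<close>
  moreover have "u = ?p" if "is_arg_min ?d (\<lambda>u. u \<in> ?S) u" for u
  proof
    fix i
    have u: "u \<in> ?S" and min: "?d u \<le> ?d ?p" using that p by (auto simp: is_arg_min_linorder)
    show "u i = ?p i"
    proof (cases "i \<in> {1..n}")
      case True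
      have "(\<Sum>i\<in>{1..n}. (?p i - z i)\<^sup>2) = (\<Sum>i\<in>{1..n}. (u i - z i)\<^sup>2)"
        using min[unfolded d_mono] le[OF u] by (meson antisym sum_mono)
      then have "(?p i - z i)\<^sup>2 = (u i - z i)\<^sup>2"
        by (rule sum_mono_inv) (use le[OF u] True in auto)
      moreover have "0 \<le> u i" using u True by (simp add: nonneg_vecs_def)
      \<comment> \<open>Equal squares leave \<open>max 0 (z i)\<close> and its mirror image at
        \<open>z i\<close>. For negative \<open>z i\<close> the latter is \<open>2 * z i\<close>,
        which nonnegativity of \<open>u i\<close> excludes.\<close>
      ultimately show ?thesis
        unfolding power2_eq_iff by (cases "0 \<le> z i") auto
    qed (use u z in \<open>auto simp: nonneg_vecs_def vecs_def\<close>)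
  qed
  ultimately show ?thesis
    unfolding euclid_proj_def arg_min_on_def arg_min_def by (rule some_equality)
qed

lemma euclid_proj_nonneg_vecs_in:
  assumes "z \<in> vecs n"
  shows "euclid_proj n (nonneg_vecs n) z \<in> nonneg_vecs n"
  unfolding euclid_proj_nonneg_vecs[OF assms] using assms by (auto simp: nonneg_vecs_def vecs_def)

text \<open>Clipping at 0 fixes the coordinates of \<open>l\<close> and does not increase distances
  on the real line.\<close>

lemma euclid_proj_nonneg_vecs_contracts:
  assumes "z \<in> vecs n" "l \<in> nonneg_vecs n"
  shows "(norm2 n (euclid_proj n (nonneg_vecs n) z - l))\<^sup>2 \<le> (norm2 n (z - l))\<^sup>2"
  unfolding norm2_squared euclid_proj_nonneg_vecs[OF assms(1)]
proof (rule sum_mono)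
  fix i assume "i \<in> {1..n}"
  then have "0 \<le> l i" using assms(2) by (simp add: nonneg_vecs_def)
  then have "\<bar>max 0 (z i) - l i\<bar> \<le> \<bar>z i - l i\<bar>" by auto
  then show "(((\<lambda>i. max 0 (z i)) - l) i)\<^sup>2 \<le> ((z - l) i)\<^sup>2"
    by (simp add: abs_le_square_iff)
qed

lemma norm2_unit_vec: "r \<in> {1..n} \<Longrightarrow> norm2 n (c *\<^sub>R unit_vec r) = \<bar>c\<bar>"
proof -
  assume r: "r \<in> {1..n}"
  have "(\<Sum>i\<in>{1..n}. ((c *\<^sub>R unit_vec r) i)\<^sup>2) = (\<Sum>i\<in>{1..n}. if r = i then c\<^sup>2 else 0)"
    by (intro sum.cong) (auto simp: unit_vec_def)
  also have "\<dots> = c\<^sup>2" using r by simp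
  finally show ?thesis by (simp add: norm2_def L2_set_def)
qed

lemma pairing_unit_vec: "r \<in> {1..n} \<Longrightarrow> pairing n y (c *\<^sub>R unit_vec r) = c * y r"
proof -
  assume r: "r \<in> {1..n}"
  have "pairing n y (c *\<^sub>R unit_vec r) = (\<Sum>i\<in>{1..n}. if r = i then c * y i else 0)"
    unfolding pairing_def by (intro sum.cong) (auto simp: unit_vec_def)
  then show ?thesis using r by simp
qed

lemma cols_mult_unit_vec: "r \<in> {1..n} \<Longrightarrow> cols_mult n G (unit_vec r) = G r"
proof
  fix i assume r: "r \<in> {1..n}"
  have "cols_mult n G (unit_vec r) i = (\<Sum>r'\<in>{1..n}. if r = r' then G r' i else 0)"
    unfolding cols_mult_def sum_fun_apply by (intro sum.cong) (auto simp: unit_vec_def)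
  then show "cols_mult n G (unit_vec r) i = G r i" using r by simp
qed

lemma abs_le_norm2: "r \<in> {1..n} \<Longrightarrow> \<bar>x r\<bar> \<le> norm2 n x"
proof -
  assume "r \<in> {1..n}"
  then have "(x r)\<^sup>2 \<le> (\<Sum>i\<in>{1..n}. (x i)\<^sup>2)" by (intro member_le_sum) auto
  then show ?thesis
    unfolding norm2_def L2_set_def by (intro real_le_rsqrt) simp
qed

section \<open>The conjugate of the regularizer\<close>

locale mirror_setting = vec_norm n N
  for n :: nat and N :: "rvec \<Rightarrow> real" +
  fixes S :: "rvec set" and K :: real and \<psi> :: "rvec \<Rightarrow> real"
  assumes S_subset: "S \<subseteq> vecs n" and S_nonempty: "S \<noteq> {}"
    and S_compact: "compact S" and S_convex: "convex S"
    and K_positive: "0 < K"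
    and \<psi>_cont: "continuous_on S \<psi>"
    and \<psi>_strong: "strongly_convex_on S N K \<psi>"
begin

abbreviation \<Phi> :: "rvec \<Rightarrow> rvec" where
  "\<Phi> \<equiv> mirror_map n S \<psi>"

text \<open>The Fenchel conjugate of \<psi> on \<open>S\<close>, written as the value at the chosen
  maximizer; \<open>conjugate_upper\<close> shows that this value is the supremum.\<close>

definition conjugate :: "rvec \<Rightarrow> real" where
  "conjugate y = pairing n y (\<Phi> y) - \<psi> (\<Phi> y)"

text \<open>Continuity and compactness provide a maximizer, so the choice behind
  \<open>arg_max\<close> returns one.\<close>

lemma mirror_map_in: "\<Phi> y \<in> S"
  and conjugate_upper: "x \<in> S \<Longrightarrow> pairing n y x - \<psi> x \<le> conjugate y"
proof -
  have "continuous_on S (\<lambda>x. pairing n y x - \<psi> x)"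
    by (intro continuous_intros continuous_on_pairing \<psi>_cont)
  from continuous_attains_sup[OF S_compact S_nonempty this]
  obtain m where "is_arg_max (\<lambda>x. pairing n y x - \<psi> x) (\<lambda>x. x \<in> S) m"
    unfolding is_arg_max_linorder by blast
  then have "is_arg_max (\<lambda>x. pairing n y x - \<psi> x) (\<lambda>x. x \<in> S) (\<Phi> y)"
    unfolding mirror_map_def arg_max_on_def arg_max_def by (rule someI[where P = "is_arg_max (\<lambda>x. pairing n y x - \<psi> x) (\<lambda>x. x \<in> S)"])
  then show "\<Phi> y \<in> S" "x \<in> S \<Longrightarrow> pairing n y x - \<psi> x \<le> conjugate y"
    by (auto simp: is_arg_max_linorder conjugate_def)
qed

text \<open>Moving from the maximizer towards \<open>z\<close> cannot raise the objective, while
  strong convexity adds a quadratic gain along the segment. Dividing by the weight of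
  \<open>z\<close> and letting it tend to 0 gives the gap.\<close>

lemma conjugate_upper_strong:
  assumes z: "z \<in> S"
  shows "pairing n y z - \<psi> z + K / 2 * (N (z - \<Phi> y))\<^sup>2 \<le> conjugate y"
proof -
  let ?x = "\<Phi> y" and ?b = "K / 2 * (N (z - \<Phi> y))\<^sup>2"
  have "?b \<le> conjugate y - (pairing n y z - \<psi> z)"
  \<comment> \<open>With \<open>u\<close> the weight of \<open>z\<close>, the gain carries the
    factor \<open>s = 1 - u\<close>; this rule replaces the limit of \<open>s\<close> towards
    1.\<close>
  proof (rule field_le_mult_one_interval)
    fix s :: real assume s: "0 < s" "s < 1"
    define u where "u = 1 - s"
    then have u: "0 < u" "u \<in> {0..1}" "s = 1 - u" using s by auto
    let ?p = "u *\<^sub>R z + (1 - u) *\<^sub>R ?x"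
    have "?p \<in> S"
      using S_convex z mirror_map_in u by (intro convexD) auto
    then have "pairing n y ?p - \<psi> ?p \<le> conjugate y" by (rule conjugate_upper)
    moreover have "\<psi> ?p \<le> u * \<psi> z + (1 - u) * \<psi> ?x - K / 2 * u * (1 - u) * (N (z - ?x))\<^sup>2"
      using \<psi>_strong z mirror_map_in[of y] u unfolding strongly_convex_on_def by blast
    ultimately have "u * (s * ?b) \<le> u * (conjugate y - (pairing n y z - \<psi> z))"
      unfolding conjugate_def u(3) by (simp add: pairing_linear algebra_simps)
    then show "s * ?b \<le> conjugate y - (pairing n y z - \<psi> z)"
      using u(1) by simp
  qed
  then show ?thesis by simp
qed

text \<open>The quadratic gap of \<open>conjugate_upper_strong\<close> at \<open>y\<close>,
  evaluated at the new maximizer, pays for the linear growth \<open>a * d\<close> through Young's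
  inequality.\<close>

lemma conjugate_smooth:
  "conjugate (y + w) \<le> conjugate y + pairing n w (\<Phi> y) + (dual_norm n N w)\<^sup>2 / (2 * K)"
proof -
  let ?x = "\<Phi> y" and ?z = "\<Phi> (y + w)"
  define a where "a = dual_norm n N w"
  define d where "d = N (?z - ?x)"
  have "?z - ?x \<in> vecs n" using mirror_map_in S_subset by (intro vecs_arith) blast+
  then have "pairing n w ?z - pairing n w ?x \<le> a * d"
    using pairing_le_dual_norm[of "?z - ?x" w] by (simp add: pairing_linear a_def d_def)
  moreover have "pairing n y ?z - \<psi> ?z + K / 2 * d\<^sup>2 \<le> conjugate y"
    unfolding d_def by (rule conjugate_upper_strong[OF mirror_map_in])
  moreover have "a * d \<le> a\<^sup>2 / (2 * K) + K / 2 * d\<^sup>2"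
  proof -
    have "0 \<le> (a - K * d)\<^sup>2 / (2 * K)" using K_positive by simp
    also have "\<dots> = a\<^sup>2 / (2 * K) + K / 2 * d\<^sup>2 - a * d"
      using K_positive by (simp add: power2_eq_square field_simps)
    finally show ?thesis by simp
  qed
  ultimately show ?thesis
    unfolding conjugate_def[of "y + w"] a_def[symmetric] by (simp add: pairing_linear)
qed

end

section \<open>The potential along the iterates\<close>

sublocale gomsp \<subseteq> mirror: mirror_setting D N \<X> K \<psi>
  by unfold_locales
    (fact N_norm dom_subset dom_nonempty dom_compact dom_convex K_pos \<psi>_continuous \<psi>_strongly_convex)+

text \<open>\<open>z\<close> is the comparison point shared by all rounds, with feasibility recorded
  for \<open>h \<circ> g\<close> as the estimates use it. \<open>C\<^sub>2\<close> bounds the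
  gradients in the quadratic error and \<open>L\<^sub>f\<close> in the linear term.\<close>

locale gomsp_bounds = gomsp +
  fixes C\<^sub>1 C\<^sub>2 C\<^sub>3 L\<^sub>f \<sigma> :: real and z :: rvec
  assumes start: "y\<^sub>1 = 0" "l\<^sub>1 = 0"
    and z_in: "z \<in> \<X>"
    and z_feasible: "\<And>t r. t \<in> {1..T} \<Longrightarrow> r \<in> {1..R} \<Longrightarrow> h (g t r z) \<le> 0"
    and C1_bound: "C\<^sub>1 \<in> C1_bounds T D R N \<X> dhg"
    and C2_bound: "C\<^sub>2 \<in> C2_bounds T D N \<X> df"
    and C3_bound: "\<And>t x. t \<in> {1..T} \<Longrightarrow> x \<in> \<X> \<Longrightarrow> norm2 R (h_constraints R h g t x) \<le> C\<^sub>3"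
    and Lf_bound: "\<And>t x. t \<in> {1..T} \<Longrightarrow> x \<in> \<X> \<Longrightarrow> dual_norm D N (df t x) \<le> L\<^sub>f"
    and noise_sq_integrable: "\<And>t. 1 \<le> t \<Longrightarrow> integrable M (\<lambda>\<omega>. (dual_norm D N (\<xi> t \<omega>))\<^sup>2)"
    and noise_sq_bound: "\<And>t. 1 \<le> t \<Longrightarrow> (\<integral>\<omega>. (dual_norm D N (\<xi> t \<omega>))\<^sup>2 \<partial>M) \<le> \<sigma>\<^sup>2"
    and step_condition: "\<gamma> * (\<alpha>\<^sup>2 + C\<^sub>1\<^sup>2 / K) \<le> \<alpha>"
begin

lemma X_in: "t \<in> {1..T + 1} \<Longrightarrow> \<omega> \<in> space M \<Longrightarrow> X t \<omega> \<in> \<X>"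
  using X_def mirror.mirror_map_in by simp

lemma in_vecs: "x \<in> \<X> \<Longrightarrow> x \<in> vecs D"
  using dom_subset by blast

lemma h_constraints_in_vecs: "h_constraints R h g t x \<in> vecs R"
  by (simp add: h_constraints_def vecs_def)

lemma \<Lambda>_nonneg:
  assumes "t \<in> {1..T + 1}" "\<omega> \<in> space M"
  shows "\<Lambda> t \<omega> \<in> nonneg_vecs R"
proof -
  \<comment> \<open>Rounds are counted from 1, hence the induction over
    \<open>t = Suc k\<close>.\<close>
  have "Suc k \<le> T + 1 \<Longrightarrow> \<Lambda> (Suc k) \<omega> \<in> nonneg_vecs R" for k
  proof (induction k)
    case 0
    then show ?case using \<Lambda>_init[OF assms(2)] l\<^sub>1_nonneg by simp
  next
    case (Suc k)
    then have "\<Lambda> (Suc k) \<omega> \<in> vecs R" by (simp add: nonneg_vecs_def)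
    then show ?case
      using \<Lambda>_step[of "Suc k" \<omega>] Suc.prems assms(2)
      by (simp add: euclid_proj_nonneg_vecs_in h_constraints_in_vecs)
  qed
  moreover obtain k where "t = Suc k" using assms(1) by (cases t) auto
  ultimately show ?thesis using assms(1) by simp
qed

text \<open>The hypothesis bounds \<open>\<gamma> * (\<alpha>\<^sup>2 + C\<^sub>1\<^sup>2 / K)\<close> by \<open>\<alpha>\<close>, which leaves no slack for
  Young's inequality with equal weights.  Here and in \<open>primal_step\<close> the weights are
  \<open>(a + b)\<^sup>2 \<le> 3 * a\<^sup>2 + 3/2 * b\<^sup>2\<close> and \<open>u * v \<le> u\<^sup>2 / 4 + v\<^sup>2\<close>: then the regularization keeps
  \<open>3/4 * \<alpha> * \<gamma>\<close> of the squared norm of the multiplier, and the quadratic error terms consume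
  exactly \<open>3/4 * \<gamma>\<^sup>2 * (\<alpha>\<^sup>2 + C\<^sub>1\<^sup>2 / K)\<close> of it.\<close>

lemma dual_step:
  assumes t: "t \<in> {1..T}" and \<omega>: "\<omega> \<in> space M" and l: "l \<in> nonneg_vecs R"
  defines "c \<equiv> h_constraints R h g t (X t \<omega>)"
  shows "(norm2 R (\<Lambda> (t + 1) \<omega> - l))\<^sup>2
    \<le> (norm2 R (\<Lambda> t \<omega> - l))\<^sup>2 + 2 * \<gamma> * pairing R c (\<Lambda> t \<omega> - l)
       + (3/2 * \<gamma>\<^sup>2 * \<alpha>\<^sup>2 - 3/2 * \<alpha> * \<gamma>) * (norm2 R (\<Lambda> t \<omega>))\<^sup>2
       + 2 * \<alpha> * \<gamma> * (norm2 R l)\<^sup>2 + 3 * \<gamma>\<^sup>2 * (norm2 R c)\<^sup>2"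
proof -
  let ?L = "\<Lambda> t \<omega>"
  have L: "?L \<in> vecs R" using \<Lambda>_nonneg[of t \<omega>] t \<omega> by (simp add: nonneg_vecs_def)
  have "(norm2 R (\<Lambda> (t + 1) \<omega> - l))\<^sup>2 \<le> (norm2 R (((1 - \<alpha> * \<gamma>) *\<^sub>R ?L + \<gamma> *\<^sub>R c) - l))\<^sup>2"
    unfolding \<Lambda>_step[OF t \<omega>] c_def
    by (intro euclid_proj_nonneg_vecs_contracts l vecs_arith L h_constraints_in_vecs)
  also have "\<dots> \<le> (\<Sum>i\<in>{1..R}. ((?L - l) i)\<^sup>2 + 2 * \<gamma> * (c i * (?L - l) i)
       + (3/2 * \<gamma>\<^sup>2 * \<alpha>\<^sup>2 - 3/2 * \<alpha> * \<gamma>) * (?L i)\<^sup>2 + 2 * \<alpha> * \<gamma> * (l i)\<^sup>2 + 3 * \<gamma>\<^sup>2 * (c i)\<^sup>2)"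
    unfolding norm2_squared
  proof (rule sum_mono)
    fix i
    \<comment> \<open>The slack consists of the two squares left over by Young's inequality, the
      first for the square of \<open>c i - \<alpha> * ?L i\<close>, the second for the cross term
      \<open>?L i * l i\<close>.\<close>
    have "(?L i - l i)\<^sup>2 + 2 * \<gamma> * (c i * (?L i - l i))
        + (3/2 * \<gamma>\<^sup>2 * \<alpha>\<^sup>2 - 3/2 * \<alpha> * \<gamma>) * (?L i)\<^sup>2 + 2 * \<alpha> * \<gamma> * (l i)\<^sup>2 + 3 * \<gamma>\<^sup>2 * (c i)\<^sup>2
        - ((1 - \<alpha> * \<gamma>) * ?L i + \<gamma> * c i - l i)\<^sup>2
      = 1/2 * \<gamma>\<^sup>2 * (2 * c i + \<alpha> * ?L i)\<^sup>2 + \<alpha> * \<gamma> / 2 * (?L i - 2 * l i)\<^sup>2"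
      by (simp add: power2_eq_square field_simps)
    also have "\<dots> \<ge> 0"
      using \<alpha>_pos \<gamma>_pos by simp
    finally show "((((1 - \<alpha> * \<gamma>) *\<^sub>R ?L + \<gamma> *\<^sub>R c) - l) i)\<^sup>2 \<le> ((?L - l) i)\<^sup>2 + 2 * \<gamma> * (c i * (?L - l) i)
       + (3/2 * \<gamma>\<^sup>2 * \<alpha>\<^sup>2 - 3/2 * \<alpha> * \<gamma>) * (?L i)\<^sup>2 + 2 * \<alpha> * \<gamma> * (l i)\<^sup>2 + 3 * \<gamma>\<^sup>2 * (c i)\<^sup>2"
      by simp
  qed
  also have "\<dots> = (norm2 R (?L - l))\<^sup>2 + 2 * \<gamma> * pairing R c (?L - l)
       + (3/2 * \<gamma>\<^sup>2 * \<alpha>\<^sup>2 - 3/2 * \<alpha> * \<gamma>) * (norm2 R ?L)\<^sup>2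
       + 2 * \<alpha> * \<gamma> * (norm2 R l)\<^sup>2 + 3 * \<gamma>\<^sup>2 * (norm2 R c)\<^sup>2"
    unfolding norm2_squared pairing_def sum.distrib sum_distrib_left by simp
  finally show ?thesis .
qed

lemma primal_step:
  assumes t: "t \<in> {1..T}" and \<omega>: "\<omega> \<in> space M"
  defines "c \<equiv> h_constraints R h g t (X t \<omega>)"
  shows "mirror.conjugate (Y (t + 1) \<omega>) - pairing D (Y (t + 1) \<omega>) z
    \<le> mirror.conjugate (Y t \<omega>) - pairing D (Y t \<omega>) z
       - \<gamma> * pairing D (df t (X t \<omega>) + \<xi> (t + 1) \<omega>) (X t \<omega> - z) - \<gamma> * pairing R c (\<Lambda> t \<omega>)
       + \<gamma>\<^sup>2 / (2 * K) * (3 * (2 * C\<^sub>2\<^sup>2 + 2 * (dual_norm D N (\<xi> (t + 1) \<omega>))\<^sup>2)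
            + 3/2 * (C\<^sub>1\<^sup>2 * (norm2 R (\<Lambda> t \<omega>))\<^sup>2))"
proof -
  let ?x = "X t \<omega>" and ?L = "\<Lambda> t \<omega>" and ?e = "\<xi> (t + 1) \<omega>"
  let ?d = "dual_norm D N"
  let ?J = "cols_mult R (\<lambda>r. dhg t r ?x) ?L"
  define u where "u = df t ?x + ?e"
  have x: "?x \<in> \<X>" using X_in t \<omega> by simp
  have L: "?L \<in> nonneg_vecs R" using \<Lambda>_nonneg t \<omega> by simp
  have sq: "(a + b)\<^sup>2 \<le> 3 * a\<^sup>2 + 3/2 * b\<^sup>2" "(a + b)\<^sup>2 \<le> 2 * a\<^sup>2 + 2 * b\<^sup>2" for a b :: real
  proof -
    have "3 * a\<^sup>2 + 3/2 * b\<^sup>2 - (a + b)\<^sup>2 = 1/2 * (2 * a - b)\<^sup>2"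
      "2 * a\<^sup>2 + 2 * b\<^sup>2 - (a + b)\<^sup>2 = (a - b)\<^sup>2"
      by (simp_all add: power2_eq_square field_simps)
    then show "(a + b)\<^sup>2 \<le> 3 * a\<^sup>2 + 3/2 * b\<^sup>2" "(a + b)\<^sup>2 \<le> 2 * a\<^sup>2 + 2 * b\<^sup>2"
      using zero_le_power2[of "2 * a - b"] zero_le_power2[of "a - b"] by linarith+
  qed
  have "(?d (df t ?x))\<^sup>2 \<le> C\<^sub>2\<^sup>2"
    using C2_bound t x by (intro power_mono mirror.dual_norm_nonneg) (auto simp: C2_bounds_def)
  moreover have "(?d u)\<^sup>2 \<le> (?d (df t ?x) + ?d ?e)\<^sup>2"
    unfolding u_def by (intro power_mono mirror.dual_norm_nonneg mirror.dual_norm_triangle)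
  ultimately have u: "(?d u)\<^sup>2 \<le> 2 * C\<^sub>2\<^sup>2 + 2 * (?d ?e)\<^sup>2"
    using sq(2)[of "?d (df t ?x)" "?d ?e"] by linarith
  have "(?d ?J)\<^sup>2 \<le> (C\<^sub>1 * norm2 R ?L)\<^sup>2"
    using C1_bound t x L by (intro power_mono mirror.dual_norm_nonneg) (auto simp: C1_bounds_def)
  then have J: "(?d ?J)\<^sup>2 \<le> C\<^sub>1\<^sup>2 * (norm2 R ?L)\<^sup>2" by (simp add: power_mult_distrib)
  have "?d ((- \<gamma>) *\<^sub>R (u + ?J)) \<le> \<gamma> * ?d (u + ?J)"
    using mirror.dual_norm_scale_le[of "- \<gamma>" "u + ?J"] \<gamma>_pos by simp
  also have "\<dots> \<le> \<gamma> * (?d u + ?d ?J)"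
    using \<gamma>_pos by (intro mult_left_mono mirror.dual_norm_triangle) simp
  finally have "(?d ((- \<gamma>) *\<^sub>R (u + ?J)))\<^sup>2 \<le> (\<gamma> * (?d u + ?d ?J))\<^sup>2"
    by (intro power_mono mirror.dual_norm_nonneg)
  also have "\<dots> = \<gamma>\<^sup>2 * (?d u + ?d ?J)\<^sup>2" by (rule power_mult_distrib)
  also have "\<dots> \<le> \<gamma>\<^sup>2 * (3 * (2 * C\<^sub>2\<^sup>2 + 2 * (?d ?e)\<^sup>2) + 3/2 * (C\<^sub>1\<^sup>2 * (norm2 R ?L)\<^sup>2))"
    using sq(1)[of "?d u" "?d ?J"] u J by (intro mult_left_mono) auto
  finally have quadratic: "(?d ((- \<gamma>) *\<^sub>R (u + ?J)))\<^sup>2 / (2 * K)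
      \<le> \<gamma>\<^sup>2 / (2 * K) * (3 * (2 * C\<^sub>2\<^sup>2 + 2 * (?d ?e)\<^sup>2) + 3/2 * (C\<^sub>1\<^sup>2 * (norm2 R ?L)\<^sup>2))"
    using K_pos by (simp add: divide_right_mono)
  have "pairing R c ?L = (\<Sum>r\<in>{1..R}. ?L r * c r)"
    by (simp add: pairing_def mult.commute)
  \<comment> \<open>Convexity of \<open>h \<circ> g\<close> and feasibility of \<open>z\<close>
    bound each component of \<open>c\<close>; nonnegative multipliers preserve the bound. The dual
    step contains the same pairing of \<open>c\<close> with the multiplier, with the opposite
    sign.\<close>
  also have "\<dots> \<le> (\<Sum>r\<in>{1..R}. ?L r * pairing D (dhg t r ?x) (?x - z))"
  proof (rule sum_mono)
    fix r assume r: "r \<in> {1..R}"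
    have "h (g t r ?x) + pairing D (dhg t r ?x) (z - ?x) \<le> h (g t r z)"
      using hg_subgradient[OF t r x] z_in by (auto simp: is_subgradient_def)
    then have "c r \<le> pairing D (dhg t r ?x) (?x - z)"
      using z_feasible[OF t r] r by (simp add: c_def h_constraints_def pairing_linear)
    then show "?L r * c r \<le> ?L r * pairing D (dhg t r ?x) (?x - z)"
      using L r by (intro mult_left_mono) (auto simp: nonneg_vecs_def)
  qed
  also have "\<dots> = pairing D ?J (?x - z)" by (simp add: pairing_cols_mult)
  finally have coupling: "\<gamma> * pairing R c ?L \<le> \<gamma> * pairing D ?J (?x - z)"
    using \<gamma>_pos by simp
  have Y: "Y (t + 1) \<omega> = Y t \<omega> + (- \<gamma>) *\<^sub>R (u + ?J)"
    unfolding Y_step[OF t \<omega>] u_def by (simp add: fun_eq_iff)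
  \<comment> \<open>The mirror image of \<open>Y t\<close> is the iterate, so the linear term of the
    smoothness bound is taken at \<open>X t\<close>.\<close>
  have x_eq: "mirror_map D \<X> \<psi> (Y t \<omega>) = ?x"
    using X_def t \<omega> by simp
  have step: "pairing D ((- \<gamma>) *\<^sub>R (u + ?J)) w = - (\<gamma> * pairing D u w) - \<gamma> * pairing D ?J w" for w
    unfolding pairing_linear(1,3) by (simp add: algebra_simps)
  have diff: "\<gamma> * pairing D w (?x - z) = \<gamma> * pairing D w ?x - \<gamma> * pairing D w z" for w
    unfolding pairing_linear(5) by (rule right_diff_distrib)
  show ?thesis
    using mirror.conjugate_smooth[of "Y t \<omega>" "(- \<gamma>) *\<^sub>R (u + ?J)", unfolded x_eq]
      quadratic coupling pairing_linear(1)[of D "Y t \<omega>" "(- \<gamma>) *\<^sub>R (u + ?J)" z]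
      step[of ?x] step[of z] diff[of u] diff[of ?J]
    unfolding u_def[symmetric] Y by linarith
qed

text \<open>Up to the constant \<open>\<psi> z\<close>, the first two terms are the Fenchel coupling
  of \<open>z\<close> and \<open>Y t\<close>, which is nonnegative; this bounds the potential below
  by \<open>- \<psi> z\<close>.\<close>

definition potential where
  "potential l t \<omega> = mirror.conjugate (Y t \<omega>) - pairing D (Y t \<omega>) z + (norm2 R (\<Lambda> t \<omega> - l))\<^sup>2 / 2"

text \<open>Compactness bounds the image of \<psi>, so that the supremum and infimum in
  \<open>range_width\<close> really are bounds.\<close>

lemma \<psi>_diff_le_range_width:
  assumes "x \<in> \<X>" "y \<in> \<X>"
  shows "\<psi> x - \<psi> y \<le> range_width \<X> \<psi>"
proof -
  have "compact (\<psi> ` \<X>)"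
    using \<psi>_continuous dom_compact by (rule compact_continuous_image)
  then have "bdd_above (\<psi> ` \<X>)" "bdd_below (\<psi> ` \<X>)"
    by (simp_all add: compact_imp_bounded bounded_imp_bdd_above bounded_imp_bdd_below)
  then show ?thesis
    unfolding range_width_def using assms by (intro diff_mono cSUP_upper cINF_lower)
qed

lemma range_width_nonneg: "0 \<le> range_width \<X> \<psi>"
  using \<psi>_diff_le_range_width[OF z_in z_in] by simp

lemma diam_bound:
  assumes "x \<in> \<X>" "y \<in> \<X>"
  shows "N (x - y) \<le> diam_wrt N \<X>"
proof -
  have "compact (N ` \<X>)"
    using dom_compact dom_subset by (intro compact_continuous_image mirror.continuous_on_norm)
  then obtain b where b: "\<And>x. x \<in> \<X> \<Longrightarrow> N x \<le> b"
    using compact_imp_bounded bounded_imp_bdd_above by (metis bdd_above.E imageI)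
  have "N (u - v) \<le> b + b" if "u \<in> \<X>" "v \<in> \<X>" for u v
  proof -
    have v: "(-1) *\<^sub>R v \<in> vecs D" using that(2) by (intro vecs_arith in_vecs)
    have "u - v = u + (-1) *\<^sub>R v" by (simp add: fun_eq_iff)
    then have "N (u - v) \<le> N u + N ((-1) *\<^sub>R v)"
      using mirror.norm_triangle[OF in_vecs v] that(1) by simp
    also have "N ((-1) *\<^sub>R v) = N v"
      using mirror.norm_scale[OF in_vecs[OF that(2)], of "-1"] by simp
    finally show ?thesis using b[OF that(1)] b[OF that(2)] by linarith
  qed
  then have "bdd_above ((\<lambda>(x, y). N (x - y)) ` (\<X> \<times> \<X>))"
    by (intro bdd_aboveI2[where M = "b + b"]) auto
  then show ?thesis
    unfolding diam_wrt_def using cSUP_upper[of "(x, y)" "\<X> \<times> \<X>" "\<lambda>(x, y). N (x - y)"] assms by simp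
qed

lemma Lf_nonneg: "0 \<le> L\<^sub>f"
  using Lf_bound[of 1 z] mirror.dual_norm_nonneg[of "df 1 z"] T_pos z_in by simp

lemma diam_nonneg: "0 \<le> diam_wrt N \<X>"
  using diam_bound[OF z_in z_in] by (simp add: mirror.norm_zero)

text \<open>The primal step and half of the dual step are added. The pairings of \<open>c\<close>
  with the current multiplier cancel and only the pairing with the fixed \<open>l\<close>
  survives.\<close>

lemma potential_step:
  assumes t: "t \<in> {1..T}" and \<omega>: "\<omega> \<in> space M" and l: "l \<in> nonneg_vecs R"
  shows "\<gamma> * pairing R (h_constraints R h g t (X t \<omega>)) l
    \<le> potential l t \<omega> - potential l (t + 1) \<omega> + \<alpha> * \<gamma> * (norm2 R l)\<^sup>2
       + \<gamma> * (diam_wrt N \<X> * L\<^sub>f) - \<gamma> * pairing D (\<xi> (t + 1) \<omega>) (X t \<omega> - z)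
       + 3/2 * \<gamma>\<^sup>2 * ((2 * C\<^sub>2\<^sup>2 + 2 * (dual_norm D N (\<xi> (t + 1) \<omega>))\<^sup>2) / K + C\<^sub>3\<^sup>2)"
proof -
  let ?x = "X t \<omega>" and ?L = "\<Lambda> t \<omega>"
  define c where "c = h_constraints R h g t ?x"
  define e where "e = (dual_norm D N (\<xi> (t + 1) \<omega>))\<^sup>2"
  define m where "m = (norm2 R ?L)\<^sup>2"
  have x: "?x \<in> \<X>" using X_in t \<omega> by simp
  \<comment> \<open>The loss enters only through this crude bound per round. Its sum grows linearly
    in time and is the source of the \<open>T powr (3/4)\<close> term.\<close>
  have "pairing D (df t ?x) (z - ?x) \<le> dual_norm D N (df t ?x) * N (z - ?x)"
    using in_vecs x z_in by (intro mirror.pairing_le_dual_norm) simp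
  also have "\<dots> \<le> L\<^sub>f * diam_wrt N \<X>"
    using x z_in t by (intro mult_mono diam_bound Lf_bound Lf_nonneg mirror.norm_nonneg vecs_arith in_vecs)
  finally have "\<gamma> * pairing D (df t ?x) (z - ?x) \<le> \<gamma> * (diam_wrt N \<X> * L\<^sub>f)"
    using \<gamma>_pos by (simp add: mult.commute)
  then have f: "- (\<gamma> * pairing D (df t ?x) (?x - z)) \<le> \<gamma> * (diam_wrt N \<X> * L\<^sub>f)"
    by (simp add: pairing_linear algebra_simps)
  have "(norm2 R c)\<^sup>2 \<le> C\<^sub>3\<^sup>2"
    unfolding c_def by (intro power_mono C3_bound[OF t x]) (simp add: norm2_def)
  then have c: "3/2 * \<gamma>\<^sup>2 * (norm2 R c)\<^sup>2 \<le> 3/2 * \<gamma>\<^sup>2 * C\<^sub>3\<^sup>2"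
    by (intro mult_left_mono) auto
  \<comment> \<open>All multiples of \<open>m\<close> from the primal step and half of the dual
    step; the step size condition makes their sum nonpositive.\<close>
  have "\<gamma>\<^sup>2 / (2 * K) * (3/2 * (C\<^sub>1\<^sup>2 * m)) + (3/2 * \<gamma>\<^sup>2 * \<alpha>\<^sup>2 - 3/2 * \<alpha> * \<gamma>) * m / 2
      = 3/4 * (\<gamma> * m) * (\<gamma> * (\<alpha>\<^sup>2 + C\<^sub>1\<^sup>2 / K) - \<alpha>)"
    by (simp add: power2_eq_square field_simps)
  also have "\<dots> \<le> 0"
    using \<gamma>_pos step_condition by (intro mult_nonneg_nonpos) (auto simp: m_def)
  finally have absorbed:
    "\<gamma>\<^sup>2 / (2 * K) * (3/2 * (C\<^sub>1\<^sup>2 * m)) + (3/2 * \<gamma>\<^sup>2 * \<alpha>\<^sup>2 - 3/2 * \<alpha> * \<gamma>) * m / 2 \<le> 0" .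
  have split: "\<gamma>\<^sup>2 / (2 * K) * (3 * (2 * C\<^sub>2\<^sup>2 + 2 * e) + 3/2 * (C\<^sub>1\<^sup>2 * m))
      = 3/2 * \<gamma>\<^sup>2 * ((2 * C\<^sub>2\<^sup>2 + 2 * e) / K) + \<gamma>\<^sup>2 / (2 * K) * (3/2 * (C\<^sub>1\<^sup>2 * m))"
    using K_pos by (simp add: field_simps)
  have final_split: "3/2 * \<gamma>\<^sup>2 * ((2 * C\<^sub>2\<^sup>2 + 2 * e) / K + C\<^sub>3\<^sup>2)
      = 3/2 * \<gamma>\<^sup>2 * ((2 * C\<^sub>2\<^sup>2 + 2 * e) / K) + 3/2 * \<gamma>\<^sup>2 * C\<^sub>3\<^sup>2"
    by (rule distrib_left)
  have lin: "\<gamma> * pairing D (df t ?x + \<xi> (t + 1) \<omega>) (?x - z)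
      = \<gamma> * pairing D (df t ?x) (?x - z) + \<gamma> * pairing D (\<xi> (t + 1) \<omega>) (?x - z)"
    "2 * \<gamma> * pairing R c (?L - l) = 2 * (\<gamma> * pairing R c ?L) - 2 * (\<gamma> * pairing R c l)"
    unfolding pairing_linear(1,5) by (simp_all add: algebra_simps)
  show ?thesis
    using primal_step[OF t \<omega>] dual_step[OF t \<omega> l] f c absorbed
    unfolding potential_def c_def[symmetric] e_def[symmetric] m_def[symmetric] split final_split lin
    by linarith
qed

text \<open>A multiple of a unit vector as multiplier singles out constraint \<open>r\<close>;
  summing \<open>potential_step\<close> telescopes the potential. The bound holds for every outcome,
  with the noise still present.\<close>

lemma cumulative_bound:
  assumes t: "t \<le> T" and \<omega>: "\<omega> \<in> space M" and r: "r \<in> {1..R}" and a: "0 \<le> a"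
  shows "\<gamma> * a * h_CFit h g X r t \<omega>
    \<le> range_width \<X> \<psi> + (1/2 + real t * (\<alpha> * \<gamma>)) * a\<^sup>2 + real t * (\<gamma> * (diam_wrt N \<X> * L\<^sub>f))
       - \<gamma> * (\<Sum>\<tau>\<in>{1..t}. pairing D (\<xi> (\<tau> + 1) \<omega>) (X \<tau> \<omega> - z))
       + 3/2 * \<gamma>\<^sup>2 * (\<Sum>\<tau>\<in>{1..t}. (2 * C\<^sub>2\<^sup>2 + 2 * (dual_norm D N (\<xi> (\<tau> + 1) \<omega>))\<^sup>2) / K + C\<^sub>3\<^sup>2)"
proof -
  define l where "l = a *\<^sub>R unit_vec r"
  have l: "l \<in> nonneg_vecs R"
    using r a by (auto simp: l_def nonneg_vecs_def vecs_def unit_vec_def)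
  have norm_l: "(norm2 R l)\<^sup>2 = a\<^sup>2"
    unfolding l_def norm2_unit_vec[OF r] by simp
  let ?rest = "\<lambda>\<tau>. \<alpha> * \<gamma> * a\<^sup>2
       + \<gamma> * (diam_wrt N \<X> * L\<^sub>f) - \<gamma> * pairing D (\<xi> (\<tau> + 1) \<omega>) (X \<tau> \<omega> - z)
       + 3/2 * \<gamma>\<^sup>2 * ((2 * C\<^sub>2\<^sup>2 + 2 * (dual_norm D N (\<xi> (\<tau> + 1) \<omega>))\<^sup>2) / K + C\<^sub>3\<^sup>2)"
  have telescoped: "(\<Sum>\<tau>\<in>{1..t}. \<gamma> * a * h (g \<tau> r (X \<tau> \<omega>)))
      \<le> potential l 1 \<omega> - potential l (t + 1) \<omega> + (\<Sum>\<tau>\<in>{1..t}. ?rest \<tau>)"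
    using t
  proof (induction t)
    case (Suc t)
    have "\<gamma> * a * h (g (Suc t) r (X (Suc t) \<omega>)) \<le> potential l (t + 1) \<omega> - potential l (Suc t + 1) \<omega> + ?rest (Suc t)"
      using potential_step[OF _ \<omega> l, of "Suc t"] Suc.prems r
      unfolding l_def[symmetric] norm_l
      by (simp add: l_def pairing_unit_vec[OF r] h_constraints_def algebra_simps)
    moreover have "(\<Sum>\<tau>\<in>{1..Suc t}. F \<tau>) = (\<Sum>\<tau>\<in>{1..t}. F \<tau>) + F (Suc t)" for F :: "nat \<Rightarrow> real"
      by simp
    moreover have "t \<le> T" using Suc.prems by simp
    ultimately show ?case using Suc.IH by (smt (verit))
  qed simp
  \<comment> \<open>Both sequences start at 0: the conjugate there is minus the minimum of \<psi>,
    and the distance to \<open>l\<close> accounts for the summand \<open>1/2\<close> in the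
    coefficient of the squared \<open>a\<close>.\<close>
  have "potential l 1 \<omega> = - \<psi> (mirror_map D \<X> \<psi> 0) + a\<^sup>2 / 2"
  proof -
    have "(norm2 R (0 - l))\<^sup>2 = (norm2 R l)\<^sup>2" by (simp add: norm2_squared)
    then show ?thesis
      unfolding potential_def Y_init[OF \<omega>] \<Lambda>_init[OF \<omega>] start norm_l mirror.conjugate_def by simp
  qed
  moreover have "- \<psi> z \<le> potential l (t + 1) \<omega>"
    using mirror.conjugate_upper[OF z_in, of "Y (t + 1) \<omega>"] unfolding potential_def
    by (smt (verit) zero_le_power2 divide_nonneg_pos)
  moreover have "\<psi> z - \<psi> (mirror_map D \<X> \<psi> 0) \<le> range_width \<X> \<psi>"
    using z_in mirror.mirror_map_in by (rule \<psi>_diff_le_range_width)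
  moreover have "(\<Sum>\<tau>\<in>{1..t}. ?rest \<tau>) = real t * (\<alpha> * \<gamma>) * a\<^sup>2 + real t * (\<gamma> * (diam_wrt N \<X> * L\<^sub>f))
       - \<gamma> * (\<Sum>\<tau>\<in>{1..t}. pairing D (\<xi> (\<tau> + 1) \<omega>) (X \<tau> \<omega> - z))
       + 3/2 * \<gamma>\<^sup>2 * (\<Sum>\<tau>\<in>{1..t}. (2 * C\<^sub>2\<^sup>2 + 2 * (dual_norm D N (\<xi> (\<tau> + 1) \<omega>))\<^sup>2) / K + C\<^sub>3\<^sup>2)"
  proof -
    have "(\<Sum>\<tau>\<in>{1..t}. p * q + b - \<gamma> * F \<tau> + k * G \<tau>)
        = real t * p * q + real t * b - \<gamma> * (\<Sum>\<tau>\<in>{1..t}. F \<tau>) + k * (\<Sum>\<tau>\<in>{1..t}. G \<tau>)"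
      for p q b k :: real and F G :: "nat \<Rightarrow> real"
      by (simp add: sum.distrib sum_subtractf sum_distrib_left distrib_left mult.assoc)
    then show ?thesis .
  qed
  moreover have "(\<Sum>\<tau>\<in>{1..t}. \<gamma> * a * h (g \<tau> r (X \<tau> \<omega>))) = \<gamma> * a * h_CFit h g X r t \<omega>"
    by (simp add: h_CFit_def sum_distrib_left)
  moreover have "(1/2 + real t * (\<alpha> * \<gamma>)) * a\<^sup>2 = a\<^sup>2 / 2 + real t * (\<alpha> * \<gamma>) * a\<^sup>2"
    by (simp add: algebra_simps)
  ultimately show ?thesis using telescoped by linarith
qed

end

section \<open>Expected violation\<close>

context gomsp_bounds
begin

text \<open>A finite \<open>C\<^sub>1\<close> bounds the chosen subgradients, which makes \<open>h \<circ> g t r\<close> Lipschitz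
  and hence measurable along the iterates.\<close>

lemma h_constraint_lipschitz:
  assumes t: "t \<in> {1..T}" and r: "r \<in> {1..R}" and "x \<in> \<X>" "y \<in> \<X>"
  shows "\<bar>h (g t r x) - h (g t r y)\<bar> \<le> C\<^sub>1 * N (x - y)"
proof -
  have le: "h (g t r x) - h (g t r y) \<le> C\<^sub>1 * N (x - y)" if x: "x \<in> \<X>" and y: "y \<in> \<X>" for x y
  proof -
    \<comment> \<open>A unit vector as multiplier extracts one column, so \<open>C\<^sub>1\<close>
      bounds each chosen subgradient.\<close>
    have "unit_vec r \<in> nonneg_vecs R"
      using r by (auto simp: unit_vec_def nonneg_vecs_def vecs_def)
    then have "dual_norm D N (cols_mult R (\<lambda>r. dhg t r x) (unit_vec r)) \<le> C\<^sub>1 * norm2 R (unit_vec r)"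
      using C1_bound t x by (auto simp: C1_bounds_def)
    then have "dual_norm D N (dhg t r x) \<le> C\<^sub>1"
      using norm2_unit_vec[OF r, of 1] by (simp add: cols_mult_unit_vec[OF r])
    moreover have xy: "x - y \<in> vecs D" using x y by (intro vecs_arith in_vecs)
    ultimately have "dual_norm D N (dhg t r x) * N (x - y) \<le> C\<^sub>1 * N (x - y)"
      by (intro mult_right_mono mirror.norm_nonneg)
    moreover have "pairing D (dhg t r x) (x - y) \<le> dual_norm D N (dhg t r x) * N (x - y)"
      using xy by (rule mirror.pairing_le_dual_norm)
    moreover have "h (g t r x) + pairing D (dhg t r x) (y - x) \<le> h (g t r y)"
      using hg_subgradient[OF t r x] y by (auto simp: is_subgradient_def)
    ultimately show ?thesis by (simp add: pairing_linear)
  qed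
  show ?thesis
    using le[of x y] le[of y x] assms mirror.norm_minus_commute[of x y] in_vecs by auto
qed

lemma X_measurable: "t \<in> {1..T + 1} \<Longrightarrow> X t \<in> M \<rightarrow>\<^sub>M borel"
  by (rule measurable_from_subalg[OF F_subalgebra X_adapted])

lemma h_constraint_integrable:
  assumes t: "t \<in> {1..T}" and r: "r \<in> {1..R}"
  shows "integrable M (\<lambda>\<omega>. h (g t r (X t \<omega>)))"
proof (rule integrable_const_bound)
  have "\<bar>h (g t r x)\<bar> \<le> C\<^sub>3" if "x \<in> \<X>" for x
    using abs_le_norm2[OF r, of "h_constraints R h g t x"] C3_bound[OF t that] r
    by (simp add: h_constraints_def)
  then show "AE \<omega> in M. norm (h (g t r (X t \<omega>))) \<le> C\<^sub>3"
    using X_in t by (intro AE_I2) simp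
  \<comment> \<open>Continuity is available on the domain only, so measurability goes through the
    restricted Borel space, into which \<open>X t\<close> maps.\<close>
  have "continuous_on \<X> (\<lambda>x. h (g t r x))"
    by (rule mirror.continuous_on_if_lipschitz[OF dom_subset h_constraint_lipschitz[OF t r]])
  then have "(\<lambda>x. h (g t r x)) \<in> borel_measurable (restrict_space borel \<X>)"
    by (rule borel_measurable_continuous_on_restrict)
  moreover have "X t \<in> M \<rightarrow>\<^sub>M restrict_space borel \<X>"
    using X_measurable X_in t by (intro measurable_restrict_space2) auto
  ultimately show "(\<lambda>\<omega>. h (g t r (X t \<omega>))) \<in> borel_measurable M"
    by (rule measurable_compose[rotated])
qed

lemma h_CFit_integrable: "t \<le> T \<Longrightarrow> r \<in> {1..R} \<Longrightarrow> integrable M (h_CFit h g X r t)"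
  unfolding h_CFit_def by (intro Bochner_Integration.integrable_sum h_constraint_integrable) auto

text \<open>\<open>X t\<close> is measurable for \<open>F t\<close>, while the noise of index
  \<open>t + 1\<close> has conditional mean 0 given \<open>F t\<close>; hence each coordinate
  product integrates to 0. Compactness of the domain bounds the first factor, which makes the
  products integrable.\<close>

lemma noise_orthogonal:
  assumes t: "t \<in> {1..T}"
  shows "integrable M (\<lambda>\<omega>. pairing D (\<xi> (t + 1) \<omega>) (X t \<omega> - z))"
    and "(\<integral>\<omega>. pairing D (\<xi> (t + 1) \<omega>) (X t \<omega> - z) \<partial>M) = 0"
proof -
  interpret Ft: sigma_finite_subalgebra M "F t"
    using F_subalgebra finite_measure_axioms
    by (intro finite_measure_subalgebra_is_sigma_finite)
      (simp add: finite_measure_subalgebra_def finite_measure_subalgebra_axioms_def)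
  have coordinate: "integrable M (\<lambda>\<omega>. (X t \<omega> i - z i) * \<xi> (t + 1) \<omega> i)
      \<and> (\<integral>\<omega>. (X t \<omega> i - z i) * \<xi> (t + 1) \<omega> i \<partial>M) = 0" if i: "i \<in> {1..D}" for i
  proof -
    have meas: "(\<lambda>\<omega>. X t \<omega> i - z i) \<in> borel_measurable (F t)"
    proof -
      have "(\<lambda>x::rvec. x i) \<in> borel_measurable borel"
        by (rule borel_measurable_continuous_onI) (rule continuous_on_coordinate)
      from measurable_compose[OF X_adapted this] show ?thesis using t by simp
    qed
    note X_meas [measurable] = measurable_from_subalg[OF F_subalgebra meas]
    have \<xi>i: "integrable M (\<lambda>\<omega>. \<xi> (t + 1) \<omega> i)" using noise_integrable[of "t + 1"] i by simp
    note \<xi>_meas = borel_measurable_integrable[OF \<xi>i]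
    have "compact ((\<lambda>x. x i - z i) ` \<X>)"
      by (intro compact_continuous_image dom_compact continuous_intros continuous_on_coordinate)
    from compact_imp_bounded[OF this]
    obtain b where b: "\<And>x. x \<in> \<X> \<Longrightarrow> \<bar>x i - z i\<bar> \<le> b"
      unfolding bounded_real by blast
    have int: "integrable M (\<lambda>\<omega>. (X t \<omega> i - z i) * \<xi> (t + 1) \<omega> i)"
    proof (rule Bochner_Integration.integrable_bound[OF integrable_mult_right[OF \<xi>i, of b]])
      show "AE \<omega> in M. norm ((X t \<omega> i - z i) * \<xi> (t + 1) \<omega> i) \<le> norm (b * \<xi> (t + 1) \<omega> i)"
      proof (rule AE_I2)
        fix \<omega> assume "\<omega> \<in> space M"
        then have "\<bar>X t \<omega> i - z i\<bar> \<le> \<bar>b\<bar>"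
          using b[OF X_in[of t \<omega>]] t by simp
        then show "norm ((X t \<omega> i - z i) * \<xi> (t + 1) \<omega> i) \<le> norm (b * \<xi> (t + 1) \<omega> i)"
          by (simp add: abs_mult mult_right_mono)
      qed
    qed (rule borel_measurable_times[OF X_meas \<xi>_meas])
    have "(\<integral>\<omega>. (X t \<omega> i - z i) * \<xi> (t + 1) \<omega> i \<partial>M)
        = (\<integral>\<omega>. (X t \<omega> i - z i) * real_cond_exp M (F t) (\<lambda>\<omega>. \<xi> (t + 1) \<omega> i) \<omega> \<partial>M)"
      by (rule Ft.real_cond_exp_intg(2)[symmetric, OF int meas \<xi>_meas])
    also have "\<dots> = (\<integral>\<omega>. 0 \<partial>M)"
    proof (rule integral_cong_AE)
      show "AE \<omega> in M. (X t \<omega> i - z i) * real_cond_exp M (F t) (\<lambda>\<omega>. \<xi> (t + 1) \<omega> i) \<omega> = 0"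
        using noise_centered[of "t + 1" i] i by (auto elim: eventually_mono)
    qed simp_all
    finally show ?thesis using int by simp
  qed
  have eq: "pairing D (\<xi> (t + 1) \<omega>) (X t \<omega> - z) = (\<Sum>i\<in>{1..D}. (X t \<omega> i - z i) * \<xi> (t + 1) \<omega> i)" for \<omega>
    by (simp add: pairing_def mult.commute)
  show "integrable M (\<lambda>\<omega>. pairing D (\<xi> (t + 1) \<omega>) (X t \<omega> - z))"
    unfolding eq using coordinate by (intro Bochner_Integration.integrable_sum) blast
  have "(\<integral>\<omega>. pairing D (\<xi> (t + 1) \<omega>) (X t \<omega> - z) \<partial>M)
      = (\<Sum>i\<in>{1..D}. \<integral>\<omega>. (X t \<omega> i - z i) * \<xi> (t + 1) \<omega> i \<partial>M)"
    unfolding eq using coordinate by (intro Bochner_Integration.integral_sum) blast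
  also have "\<dots> = 0" using coordinate by (intro sum.neutral) blast
  finally show "(\<integral>\<omega>. pairing D (\<xi> (t + 1) \<omega>) (X t \<omega> - z) \<partial>M) = 0" .
qed

text \<open>Taking expectations removes the martingale term and replaces the squared noise by its
  bound. As \<open>a\<close> is deterministic, it can still be optimized afterwards.\<close>

lemma expected_cumulative_bound:
  assumes t: "t \<le> T" and r: "r \<in> {1..R}" and a: "0 \<le> a"
  shows "\<gamma> * a * (\<integral>\<omega>. h_CFit h g X r t \<omega> \<partial>M)
    \<le> range_width \<X> \<psi> + (1/2 + real t * (\<alpha> * \<gamma>)) * a\<^sup>2 + real t * (\<gamma> * (diam_wrt N \<X> * L\<^sub>f))
       + 3/2 * \<gamma>\<^sup>2 * (real t * ((2 * C\<^sub>2\<^sup>2 / K + C\<^sub>3\<^sup>2) + 2 * \<sigma>\<^sup>2 / K))"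
proof -
  define b where "b = range_width \<X> \<psi> + (1/2 + real t * (\<alpha> * \<gamma>)) * a\<^sup>2 + real t * (\<gamma> * (diam_wrt N \<X> * L\<^sub>f))"
  define n where "n \<tau> \<omega> = pairing D (\<xi> (\<tau> + 1) \<omega>) (X \<tau> \<omega> - z)" for \<tau> \<omega>
  define e where "e \<tau> \<omega> = (dual_norm D N (\<xi> (\<tau> + 1) \<omega>))\<^sup>2" for \<tau> \<omega>
  have n: "integrable M (n \<tau>)" "(\<integral>\<omega>. n \<tau> \<omega> \<partial>M) = 0" if "\<tau> \<in> {1..t}" for \<tau>
    using noise_orthogonal[of \<tau>] that t by (simp_all add: n_def[abs_def])
  have e: "integrable M (e \<tau>)" "(\<integral>\<omega>. e \<tau> \<omega> \<partial>M) \<le> \<sigma>\<^sup>2" for \<tau>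
    using noise_sq_integrable[of "\<tau> + 1"] noise_sq_bound[of "\<tau> + 1"] by (simp_all add: e_def[abs_def])
  have e_int: "integrable M (\<lambda>\<omega>. (2 * C\<^sub>2\<^sup>2 + 2 * e \<tau> \<omega>) / K + C\<^sub>3\<^sup>2)" for \<tau>
    using e(1)[of \<tau>] by simp
  have e_le: "(\<integral>\<omega>. (2 * C\<^sub>2\<^sup>2 + 2 * e \<tau> \<omega>) / K + C\<^sub>3\<^sup>2 \<partial>M) \<le> (2 * C\<^sub>2\<^sup>2 / K + C\<^sub>3\<^sup>2) + 2 * \<sigma>\<^sup>2 / K" for \<tau>
  proof -
    have "(\<integral>\<omega>. (2 * C\<^sub>2\<^sup>2 + 2 * e \<tau> \<omega>) / K + C\<^sub>3\<^sup>2 \<partial>M) = (2 * C\<^sub>2\<^sup>2 + 2 * (\<integral>\<omega>. e \<tau> \<omega> \<partial>M)) / K + C\<^sub>3\<^sup>2"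
      using e(1)[of \<tau>] by (simp add: prob_space)
    also have "\<dots> \<le> (2 * C\<^sub>2\<^sup>2 + 2 * \<sigma>\<^sup>2) / K + C\<^sub>3\<^sup>2"
      using e(2)[of \<tau>] K_pos by (intro add_right_mono divide_right_mono) auto
    finally show ?thesis by (simp add: add_divide_distrib)
  qed
  have "\<gamma> * a * (\<integral>\<omega>. h_CFit h g X r t \<omega> \<partial>M) = (\<integral>\<omega>. \<gamma> * a * h_CFit h g X r t \<omega> \<partial>M)"
    by simp
  also have "\<dots> \<le> (\<integral>\<omega>. b - \<gamma> * (\<Sum>\<tau>\<in>{1..t}. n \<tau> \<omega>)
      + 3/2 * \<gamma>\<^sup>2 * (\<Sum>\<tau>\<in>{1..t}. (2 * C\<^sub>2\<^sup>2 + 2 * e \<tau> \<omega>) / K + C\<^sub>3\<^sup>2) \<partial>M)"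
  proof (rule integral_mono)
    show "integrable M (\<lambda>\<omega>. \<gamma> * a * h_CFit h g X r t \<omega>)"
      using h_CFit_integrable[OF t r] by simp
    show "integrable M (\<lambda>\<omega>. b - \<gamma> * (\<Sum>\<tau>\<in>{1..t}. n \<tau> \<omega>)
      + 3/2 * \<gamma>\<^sup>2 * (\<Sum>\<tau>\<in>{1..t}. (2 * C\<^sub>2\<^sup>2 + 2 * e \<tau> \<omega>) / K + C\<^sub>3\<^sup>2))"
      by (intro Bochner_Integration.integrable_add Bochner_Integration.integrable_diff integrable_mult_right Bochner_Integration.integrable_sum e_int n(1) integrable_const)
  qed (use cumulative_bound[OF t _ r a] in \<open>simp add: b_def n_def e_def\<close>)
  also have "\<dots> = b - \<gamma> * (\<Sum>\<tau>\<in>{1..t}. \<integral>\<omega>. n \<tau> \<omega> \<partial>M)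
      + 3/2 * \<gamma>\<^sup>2 * (\<Sum>\<tau>\<in>{1..t}. \<integral>\<omega>. (2 * C\<^sub>2\<^sup>2 + 2 * e \<tau> \<omega>) / K + C\<^sub>3\<^sup>2 \<partial>M)"
  proof -
    have n_sum: "integrable M (\<lambda>\<omega>. \<Sum>\<tau>\<in>{1..t}. n \<tau> \<omega>)"
      by (intro Bochner_Integration.integrable_sum n(1))
    have e_sum: "integrable M (\<lambda>\<omega>. \<Sum>\<tau>\<in>{1..t}. (2 * C\<^sub>2\<^sup>2 + 2 * e \<tau> \<omega>) / K + C\<^sub>3\<^sup>2)"
      by (intro Bochner_Integration.integrable_sum e_int)
    have "(\<integral>\<omega>. b - \<gamma> * (\<Sum>\<tau>\<in>{1..t}. n \<tau> \<omega>) + 3/2 * \<gamma>\<^sup>2 * (\<Sum>\<tau>\<in>{1..t}. (2 * C\<^sub>2\<^sup>2 + 2 * e \<tau> \<omega>) / K + C\<^sub>3\<^sup>2) \<partial>M)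
      = (\<integral>\<omega>. b - \<gamma> * (\<Sum>\<tau>\<in>{1..t}. n \<tau> \<omega>) \<partial>M)
        + (\<integral>\<omega>. 3/2 * \<gamma>\<^sup>2 * (\<Sum>\<tau>\<in>{1..t}. (2 * C\<^sub>2\<^sup>2 + 2 * e \<tau> \<omega>) / K + C\<^sub>3\<^sup>2) \<partial>M)"
      by (intro Bochner_Integration.integral_add Bochner_Integration.integrable_diff integrable_mult_right n_sum e_sum integrable_const)
    also have "(\<integral>\<omega>. b - \<gamma> * (\<Sum>\<tau>\<in>{1..t}. n \<tau> \<omega>) \<partial>M) = b - \<gamma> * (\<integral>\<omega>. (\<Sum>\<tau>\<in>{1..t}. n \<tau> \<omega>) \<partial>M)"
      using n_sum by (subst Bochner_Integration.integral_diff) (simp_all add: prob_space)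
    also have "(\<integral>\<omega>. (\<Sum>\<tau>\<in>{1..t}. n \<tau> \<omega>) \<partial>M) = (\<Sum>\<tau>\<in>{1..t}. \<integral>\<omega>. n \<tau> \<omega> \<partial>M)"
      by (intro Bochner_Integration.integral_sum n(1))
    also have "(\<integral>\<omega>. 3/2 * \<gamma>\<^sup>2 * (\<Sum>\<tau>\<in>{1..t}. (2 * C\<^sub>2\<^sup>2 + 2 * e \<tau> \<omega>) / K + C\<^sub>3\<^sup>2) \<partial>M)
        = 3/2 * \<gamma>\<^sup>2 * (\<integral>\<omega>. (\<Sum>\<tau>\<in>{1..t}. (2 * C\<^sub>2\<^sup>2 + 2 * e \<tau> \<omega>) / K + C\<^sub>3\<^sup>2) \<partial>M)"
      by (rule integral_mult_right_zero)
    also have "(\<integral>\<omega>. (\<Sum>\<tau>\<in>{1..t}. (2 * C\<^sub>2\<^sup>2 + 2 * e \<tau> \<omega>) / K + C\<^sub>3\<^sup>2) \<partial>M)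
        = (\<Sum>\<tau>\<in>{1..t}. \<integral>\<omega>. (2 * C\<^sub>2\<^sup>2 + 2 * e \<tau> \<omega>) / K + C\<^sub>3\<^sup>2 \<partial>M)"
      by (intro Bochner_Integration.integral_sum e_int)
    finally show ?thesis .
  qed
  also have "(\<Sum>\<tau>\<in>{1..t}. \<integral>\<omega>. n \<tau> \<omega> \<partial>M) = 0"
    using n(2) by (intro sum.neutral) blast
  also have "b - \<gamma> * 0 + 3/2 * \<gamma>\<^sup>2 * (\<Sum>\<tau>\<in>{1..t}. \<integral>\<omega>. (2 * C\<^sub>2\<^sup>2 + 2 * e \<tau> \<omega>) / K + C\<^sub>3\<^sup>2 \<partial>M)
      \<le> b - \<gamma> * 0 + 3/2 * \<gamma>\<^sup>2 * (\<Sum>\<tau>\<in>{1..t}. (2 * C\<^sub>2\<^sup>2 / K + C\<^sub>3\<^sup>2) + 2 * \<sigma>\<^sup>2 / K)"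
    by (intro add_left_mono mult_left_mono sum_mono e_le) simp
  finally show ?thesis by (simp add: b_def)
qed

end

section \<open>Choice of the multiplier and the resulting rates\<close>

lemma optimize_multiplier:
  fixes \<gamma> q P m :: real
  assumes "0 < \<gamma>" "0 < q" "0 < P"
    and le: "\<And>a. 0 \<le> a \<Longrightarrow> \<gamma> * a * m \<le> P + q * a\<^sup>2"
  shows "m \<le> 2 * sqrt q * sqrt P / \<gamma>"
proof -
  define p s where "p = sqrt P" and "s = sqrt q"
  have p: "0 < p" "P = p\<^sup>2" and s: "0 < s" "q = s\<^sup>2" using assms by (simp_all add: p_def s_def)
  \<comment> \<open>This \<open>a\<close> minimizes \<open>P / a + q * a\<close> and makes both
    terms on the right equal to \<open>P\<close>; the sign of \<open>m\<close> is arbitrary.\<close>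
  have "\<gamma> * (p / s) * m \<le> p\<^sup>2 + s\<^sup>2 * (p / s)\<^sup>2"
    using le[of "p / s"] p s by simp
  also have "\<dots> = 2 * p * s * (p / s)" using s(1) by (simp add: power2_eq_square field_simps)
  finally have "\<gamma> * m * (p / s) \<le> 2 * p * s * (p / s)" by (simp add: mult_ac)
  then have "\<gamma> * m \<le> 2 * p * s" using p s by (simp only: mult_le_cancel_right) simp
  then show ?thesis
    using assms(1) by (simp add: p_def[symmetric] s_def[symmetric] field_simps)
qed

text \<open>In powers of \<open>T\<close>, the coefficient of the squared multiplier is bounded and
  the remaining terms have orders \<open>W\<close>, \<open>T powr (1/2) * V\<close> and
  \<open>S\<close>. Subadditivity of the square root separates them, and division by \<gamma> costs
  another factor of order \<open>T powr (1/2)\<close>.\<close>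

lemma step_size_rates:
  fixes c\<^sub>1 c\<^sub>2 \<gamma> \<alpha> W V S m :: real and T :: nat
  assumes c: "0 < c\<^sub>1" "0 < c\<^sub>2" and T: "0 < T" and nn: "0 \<le> W" "0 \<le> V" "0 < S"
    and \<gamma>: "c\<^sub>1 * real T powr (-1/2) \<le> \<gamma>" "\<gamma> \<le> c\<^sub>2 * real T powr (-1/2)"
    and \<alpha>: "0 \<le> \<alpha>" "\<alpha> \<le> c\<^sub>2 * real T powr (-1/2)"
    and le: "\<And>a. 0 \<le> a \<Longrightarrow>
      \<gamma> * a * m \<le> W + (1/2 + real T * (\<alpha> * \<gamma>)) * a\<^sup>2 + real T * (\<gamma> * V) + 3/2 * \<gamma>\<^sup>2 * (real T * S)"
  defines "A \<equiv> 2 * sqrt (1/2 + c\<^sub>2\<^sup>2) / c\<^sub>1"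
  shows "m \<le> sqrt W * (A * real T powr (1/2)) + sqrt V * (A * sqrt c\<^sub>2 * real T powr (3/4))
      + sqrt S * (A * c\<^sub>2 * sqrt (3/2) * real T powr (1/2))"
proof -
  define p where "p = real T powr (1/2)"
  define q where "q = real T powr (1/4)"
  have p: "0 < p" and q: "0 < q" using T by (simp_all add: p_def q_def)
  have T_eq: "real T = p\<^sup>2" and pq: "p = q\<^sup>2" and pq34: "real T powr (3/4) = p * q"
    using T by (simp_all add: p_def q_def power2_eq_square flip: powr_add)
  have inv: "real T powr (-1/2) = 1 / p" by (simp add: p_def powr_minus_divide)
  have \<gamma>p: "c\<^sub>1 / p \<le> \<gamma>" "\<gamma> * p \<le> c\<^sub>2" and \<alpha>p: "\<alpha> * p \<le> c\<^sub>2"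
    using \<gamma>[unfolded inv] \<alpha>(2)[unfolded inv] p by (simp_all add: field_simps)
  have \<gamma>_pos: "0 < \<gamma>" using \<gamma>p(1) c(1) p by (meson divide_pos_pos less_le_trans)
  have "real T * (\<alpha> * \<gamma>) = (\<alpha> * p) * (\<gamma> * p)" by (simp add: T_eq power2_eq_square)
  also have "\<dots> \<le> c\<^sub>2 * c\<^sub>2" using \<alpha>p \<gamma>p(2) \<alpha>(1) \<gamma>_pos p c by (intro mult_mono) auto
  finally have dual: "1/2 + real T * (\<alpha> * \<gamma>) \<le> 1/2 + c\<^sub>2\<^sup>2" by (simp add: power2_eq_square)
  have "real T * (\<gamma> * V) = (\<gamma> * p) * (p * V)" by (simp add: T_eq power2_eq_square)
  also have "\<dots> \<le> c\<^sub>2 * (p * V)" using \<gamma>p(2) p nn by (intro mult_right_mono) auto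
  finally have regret: "real T * (\<gamma> * V) \<le> c\<^sub>2 * (p * V)" .
  have "3/2 * \<gamma>\<^sup>2 * (real T * S) = 3/2 * (\<gamma> * p)\<^sup>2 * S" by (simp add: T_eq power_mult_distrib)
  also have "\<dots> \<le> 3/2 * c\<^sub>2\<^sup>2 * S"
    using \<gamma>p(2) \<gamma>_pos p nn by (intro mult_right_mono mult_left_mono power_mono) auto
  finally have noise: "3/2 * \<gamma>\<^sup>2 * (real T * S) \<le> 3/2 * c\<^sub>2\<^sup>2 * S" .
  define P where "P = W + c\<^sub>2 * (p * V) + 3/2 * c\<^sub>2\<^sup>2 * S"
  have P: "0 < P" using nn c p by (simp add: P_def add_nonneg_pos)
  have "m \<le> 2 * sqrt (1/2 + c\<^sub>2\<^sup>2) * sqrt P / \<gamma>"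
  proof (rule optimize_multiplier[OF \<gamma>_pos _ P])
    show "0 < 1/2 + c\<^sub>2\<^sup>2" by (simp add: add_pos_nonneg)
    fix a :: real assume "0 \<le> a"
    from le[OF this] show "\<gamma> * a * m \<le> P + (1/2 + c\<^sub>2\<^sup>2) * a\<^sup>2"
      using mult_right_mono[OF dual zero_le_power2[of a]] regret noise unfolding P_def by linarith
  qed
  also have "\<dots> \<le> 2 * sqrt (1/2 + c\<^sub>2\<^sup>2) * sqrt P / (c\<^sub>1 / p)"
    using \<gamma>p(1) \<gamma>_pos c p P by (intro divide_left_mono) auto
  also have "\<dots> = A * p * sqrt P" using p c by (simp add: A_def)
  also have "\<dots> \<le> A * p * (sqrt W + sqrt c\<^sub>2 * q * sqrt V + sqrt (3/2) * c\<^sub>2 * sqrt S)"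
  proof (rule mult_left_mono)
    have "sqrt P \<le> sqrt (W + c\<^sub>2 * (p * V)) + sqrt (3/2 * c\<^sub>2\<^sup>2 * S)"
      unfolding P_def using nn c p by (intro sqrt_add_le_add_sqrt) auto
    also have "sqrt (W + c\<^sub>2 * (p * V)) \<le> sqrt W + sqrt (c\<^sub>2 * (p * V))"
      using nn c p by (intro sqrt_add_le_add_sqrt) auto
    also have "sqrt (c\<^sub>2 * (p * V)) = sqrt c\<^sub>2 * q * sqrt V"
      using q by (simp add: pq real_sqrt_mult)
    also have "sqrt (3/2 * c\<^sub>2\<^sup>2 * S) = sqrt (3/2) * c\<^sub>2 * sqrt S"
      unfolding real_sqrt_mult using c by simp
    finally show "sqrt P \<le> sqrt W + sqrt c\<^sub>2 * q * sqrt V + sqrt (3/2) * c\<^sub>2 * sqrt S" by simp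
    show "0 \<le> A * p" using c p by (simp add: A_def)
  qed
  finally show ?thesis
    unfolding pq34 p_def[symmetric] by (simp add: algebra_simps)
qed

text \<open>The constants are chosen before the dimensions, the horizon and all problem data, which
  expresses that they depend on the step size constants alone. The integrability claim ensures that
  the integral is a genuine expectation and not the default value 0.\<close>

theorem corollary10:
  fixes c\<^sub>1 c\<^sub>2 :: real
  assumes "0 < c\<^sub>1" and "0 < c\<^sub>2"
  shows "\<exists>A B E :: real. 0 \<le> A \<and> 0 \<le> B \<and> 0 \<le> E \<and>
    (\<forall>(T::nat) (D::nat) (R::nat) N \<X> f df g h dhg (M :: 'w measure) F \<xi> K \<psi> \<gamma> \<alpha> Y \<Lambda> X
        (C\<^sub>1::real) C\<^sub>2 C\<^sub>3 L\<^sub>f \<sigma>.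
      gomsp T D R N \<X> f df g h dhg M F \<xi> K \<psi> \<gamma> \<alpha> 0 0 Y \<Lambda> X \<longrightarrow>
      is_smallest (C1_bounds T D R N \<X> dhg) C\<^sub>1 \<longrightarrow>
      is_smallest (C2_bounds T D N \<X> df) C\<^sub>2 \<longrightarrow>
      0 < C\<^sub>3 \<longrightarrow>
      (\<forall>t\<in>{1..T}. \<forall>x\<in>\<X>. norm2 R (h_constraints R h g t x) \<le> C\<^sub>3) \<longrightarrow>
      h 0 \<le> 0 \<longrightarrow>
      (\<Inter>\<tau>\<in>{1..T}. {x \<in> \<X>. \<forall>r\<in>{1..R}. g \<tau> r x \<le> 0}) \<noteq> {} \<longrightarrow>
      (\<forall>t\<in>{1..T}. \<forall>x\<in>\<X>. dual_norm D N (df t x) \<le> L\<^sub>f) \<longrightarrow>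
      0 < \<sigma> \<longrightarrow>
      (\<forall>\<tau>\<ge>1. integrable M (\<lambda>\<omega>. (dual_norm D N (\<xi> \<tau> \<omega>))\<^sup>2) \<and>
               (\<integral>\<omega>. (dual_norm D N (\<xi> \<tau> \<omega>))\<^sup>2 \<partial>M) \<le> \<sigma>\<^sup>2) \<longrightarrow>
      c\<^sub>1 * real T powr (-1/2) \<le> \<gamma> \<longrightarrow> \<gamma> \<le> c\<^sub>2 * real T powr (-1/2) \<longrightarrow>
      c\<^sub>1 * real T powr (-1/2) \<le> \<alpha> \<longrightarrow> \<alpha> \<le> c\<^sub>2 * real T powr (-1/2) \<longrightarrow>
      0 \<le> \<alpha> - \<gamma> * (\<alpha>\<^sup>2 + C\<^sub>1\<^sup>2 / K) \<longrightarrow>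
      (\<forall>r\<in>{1..R}. \<forall>t\<in>{1..T}.
         integrable M (h_CFit h g X r t) \<and>
         (\<integral>\<omega>. h_CFit h g X r t \<omega> \<partial>M)
           \<le> sqrt (range_width \<X> \<psi>) * (A * real T powr (1/2))
             + sqrt (diam_wrt N \<X> * L\<^sub>f) * (B * real T powr (3/4))
             + sqrt ((2 * C\<^sub>2\<^sup>2 / K + C\<^sub>3\<^sup>2) + 2 * \<sigma>\<^sup>2 / K) * (E * real T powr (1/2))))"
proof -
  define A where "A = 2 * sqrt (1/2 + c\<^sub>2\<^sup>2) / c\<^sub>1"
  have A: "0 \<le> A" using assms by (simp add: A_def)
  show ?thesis
  proof (intro exI conjI allI impI ballI)
    show "0 \<le> A" "0 \<le> A * sqrt c\<^sub>2" "0 \<le> A * c\<^sub>2 * sqrt (3/2)"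
      using A assms by simp_all
    fix T D R N \<X> f df g h dhg and M :: "'w measure" and F \<xi> K \<psi> \<gamma> \<alpha> Y \<Lambda> X
      and C\<^sub>1 C\<^sub>2 C\<^sub>3 L\<^sub>f \<sigma> :: real and r t
    assume gomsp: "gomsp T D R N \<X> f df g h dhg M F \<xi> K \<psi> \<gamma> \<alpha> 0 0 Y \<Lambda> X"
      and C1: "is_smallest (C1_bounds T D R N \<X> dhg) C\<^sub>1"
      and C2: "is_smallest (C2_bounds T D N \<X> df) C\<^sub>2"
      and C3: "0 < C\<^sub>3" "\<forall>t\<in>{1..T}. \<forall>x\<in>\<X>. norm2 R (h_constraints R h g t x) \<le> C\<^sub>3"
      and h0: "h 0 \<le> 0"
      and feasible: "(\<Inter>\<tau>\<in>{1..T}. {x \<in> \<X>. \<forall>r\<in>{1..R}. g \<tau> r x \<le> 0}) \<noteq> {}"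
      and Lf: "\<forall>t\<in>{1..T}. \<forall>x\<in>\<X>. dual_norm D N (df t x) \<le> L\<^sub>f"
      and \<sigma>: "0 < \<sigma>"
        "\<forall>\<tau>\<ge>1. integrable M (\<lambda>\<omega>. (dual_norm D N (\<xi> \<tau> \<omega>))\<^sup>2) \<and>
               (\<integral>\<omega>. (dual_norm D N (\<xi> \<tau> \<omega>))\<^sup>2 \<partial>M) \<le> \<sigma>\<^sup>2"
      and \<gamma>: "c\<^sub>1 * real T powr (-1/2) \<le> \<gamma>" "\<gamma> \<le> c\<^sub>2 * real T powr (-1/2)"
      and \<alpha>: "c\<^sub>1 * real T powr (-1/2) \<le> \<alpha>" "\<alpha> \<le> c\<^sub>2 * real T powr (-1/2)"
      and step: "0 \<le> \<alpha> - \<gamma> * (\<alpha>\<^sup>2 + C\<^sub>1\<^sup>2 / K)"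
      and r: "r \<in> {1..R}" and t: "t \<in> {1..T}"
    interpret gomsp T D R N \<X> f df g h dhg M F \<xi> K \<psi> \<gamma> \<alpha> 0 0 Y \<Lambda> X by (fact gomsp)
    obtain z where z: "z \<in> (\<Inter>\<tau>\<in>{1..T}. {x \<in> \<X>. \<forall>r\<in>{1..R}. g \<tau> r x \<le> 0})"
      using feasible by blast
    interpret gomsp_bounds T D R N \<X> f df g h dhg M F \<xi> K \<psi> \<gamma> \<alpha> 0 0 Y \<Lambda> X C\<^sub>1 C\<^sub>2 C\<^sub>3 L\<^sub>f \<sigma> z
    proof
      \<comment> \<open>A positive horizon matters: an intersection over no rounds would be the
        whole space.\<close>
      show "z \<in> \<X>" using z T_pos by fastforce
      fix t r assume "t \<in> {1..T}" "r \<in> {1..R}"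
      then have "h (g t r z) \<le> h 0" using z by (intro monoD[OF h_mono]) blast
      then show "h (g t r z) \<le> 0" using h0 by simp
    qed (use C1 C2 C3 Lf \<sigma> step in \<open>auto simp: is_smallest_def\<close>)
    let ?S = "(2 * C\<^sub>2\<^sup>2 / K + C\<^sub>3\<^sup>2) + 2 * \<sigma>\<^sup>2 / K"
    \<comment> \<open>Strict positivity, due to \<open>C\<^sub>3\<close>, makes the optimal
      multiplier nonzero.\<close>
    have S: "0 < ?S" using C3 K_pos by (intro add_pos_nonneg add_nonneg_pos) auto
    have t_le: "t \<le> T" using t by simp
    show "integrable M (h_CFit h g X r t)" by (rule h_CFit_integrable[OF t_le r])
    have LD: "0 \<le> diam_wrt N \<X> * L\<^sub>f" using diam_nonneg Lf_nonneg by simp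
    \<comment> \<open>Every term containing \<open>t\<close> has a nonnegative coefficient, so
      \<open>t\<close> may be enlarged to the horizon \<open>T\<close> before the rates are
      computed.\<close>
    have "\<gamma> * a * (\<integral>\<omega>. h_CFit h g X r t \<omega> \<partial>M)
      \<le> range_width \<X> \<psi> + (1/2 + real T * (\<alpha> * \<gamma>)) * a\<^sup>2 + real T * (\<gamma> * (diam_wrt N \<X> * L\<^sub>f))
         + 3/2 * \<gamma>\<^sup>2 * (real T * ?S)" if "0 \<le> a" for a
    proof (rule order_trans[OF expected_cumulative_bound[OF t_le r that]])
      show "range_width \<X> \<psi> + (1/2 + real t * (\<alpha> * \<gamma>)) * a\<^sup>2 + real t * (\<gamma> * (diam_wrt N \<X> * L\<^sub>f))
          + 3/2 * \<gamma>\<^sup>2 * (real t * ?S)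
        \<le> range_width \<X> \<psi> + (1/2 + real T * (\<alpha> * \<gamma>)) * a\<^sup>2 + real T * (\<gamma> * (diam_wrt N \<X> * L\<^sub>f))
          + 3/2 * \<gamma>\<^sup>2 * (real T * ?S)"
        using t_le \<gamma>_pos \<alpha>_pos diam_nonneg Lf_nonneg less_imp_le[OF S]
        by (intro add_mono order_refl mult_right_mono mult_left_mono mult_nonneg_nonneg) auto
    qed
    from step_size_rates[OF assms T_pos range_width_nonneg LD S \<gamma> less_imp_le[OF \<alpha>_pos] \<alpha>(2) this]
    show "(\<integral>\<omega>. h_CFit h g X r t \<omega> \<partial>M)
           \<le> sqrt (range_width \<X> \<psi>) * (A * real T powr (1/2))
             + sqrt (diam_wrt N \<X> * L\<^sub>f) * (A * sqrt c\<^sub>2 * real T powr (3/4))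
             + sqrt ?S * (A * c\<^sub>2 * sqrt (3/2) * real T powr (1/2))"
      unfolding A_def .
  qed
qed

end
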